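(* A unit geodesic vector field $\xi$ on the unit sphere $S^{n+1}$ is totally geodesic if and only if $n=2m$ for some integer $m$ and $\xi$ is a strongly normal invariant unit vector field.
   Context: $\langle\cdot,\cdot\rangle$ is the Riemannian metric of a manifold $M$ (here $M=S^{n+1}$ with the round metric) and $\nabla$ its Levi-Civita connection. A unit vector field $\xi$ is geodesic if its integral trajectories are geodesics, i.e. $\nabla_\xi\xi=0$. Put $A_\xi X=-\nabla_X\xi$ and $(\nabla_XA_\xi)Y=-(\nabla_X\nabla_Y\xi-\nabla_{\nabla_XY}\xi)$. The unit field $\xi$ is strongly normal if $\langle(\nabla_XA_\xi)Y,Z\rangle=0$ for all $X,Y,Z\in\xi^\perp$. Sasaki metric: at $Q=(q,\xi)\in TM$, each $X\in T_qM$ has a horizontal lift $X^h$ and a vertical lift $X^v$ in $T_QTM$ (with respect to $\nabla$); the Sasaki metric $g_S$ on $TM$ is determined by $\langle\langle X^h,Y^h\rangle\rangle=\langle X,Y\rangle$, $\langle\langle X^h,Y^v\rangle\rangle=0$, $\langle\langle X^v,Y^v\rangle\rangle=\langle X,Y\rangle$. The unit tangent bundle $T_1M$ carries the induced metric; its unit normal in $TM$ at $(q,\xi)$ is $\xi^v$. A unit vector field $\xi$ on $M$ is totally geodesic if the image of the imbedding $\xi:M\to T_1M$, $q\mapsto(q,\xi(q))$, is a totally geodesic submanifold of $T_1M$ with the Sasaki metric. Invariant fields: let $J$ be the almost complex structure on $TM$ with $JX^h=X^v$, $JX^v=-X^h$. On $T_1M$ define, at $(q,\xi)$, $\bar\xi=-J\xi^v=\xi^h$,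 and a 1-form $\bar\eta$ and $(1,1)$-tensor $\bar\varphi$ by $J\tilde X=\bar\varphi\tilde X+\bar\eta(\tilde X)\xi^v$ for $\tilde X$ tangent to $T_1M$ (with $\bar\varphi\tilde X$ tangent to $T_1M$). Put $\tilde\xi=2\bar\xi$, $\tilde\eta=\tfrac12\bar\eta$, $\tilde\varphi=\bar\varphi$, $g_{cm}=\tfrac14g_S$. A unit vector field $\xi$ on $M$ is invariant if the submanifold $N=\xi(M)\subset(T_1M,g_{cm})$ satisfies $\tilde\varphi(T_pN)\subset T_pN$ for every $p\in N$. *)

theory Defs
  imports "HOL-Analysis.Analysis"
begin

text \<open>
  Manifolds are embedded submanifolds \<open>M\<close> of a Euclidean space \<open>'a\<close>. Tensors and vector
  fields are total functions on \<open>'a\<close>; only their values at points of \<open>M\<close> and on tangent vectors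
  of \<open>M\<close> matter. A Riemannian metric is a function \<open>g p v w\<close>.
\<close>

section \<open>Smooth maps and vector fields on embedded submanifolds\<close>

primrec Ck_on :: "nat \<Rightarrow> 'a::real_normed_vector set \<Rightarrow> ('a \<Rightarrow> 'b::real_normed_vector) \<Rightarrow> bool" where
  "Ck_on 0 U f \<longleftrightarrow> continuous_on U f"
| "Ck_on (Suc k) U f \<longleftrightarrow> (\<forall>x\<in>U. f differentiable (at x)) \<and>
     (\<forall>v. Ck_on k U (\<lambda>x. frechet_derivative f (at x) v))"

definition smooth_on :: "'a::real_normed_vector set \<Rightarrow> ('a \<Rightarrow> 'b::real_normed_vector) \<Rightarrow> bool" where
  "smooth_on U f \<longleftrightarrow> (\<forall>k. Ck_on k U f)"

definition smooth_map :: "'a::real_normed_vector set \<Rightarrow> ('a \<Rightarrow> 'b::real_normed_vector) \<Rightarrow> bool" where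
  "smooth_map M f \<longleftrightarrow>
     (\<forall>p\<in>M. \<exists>U F. open U \<and> p \<in> U \<and> smooth_on U F \<and> (\<forall>x\<in>M \<inter> U. F x = f x))"

definition tangent_space :: "'a::real_normed_vector set \<Rightarrow> 'a \<Rightarrow> 'a set" where
  "tangent_space M p = {v. \<exists>\<gamma> e. e > 0 \<and> smooth_on {-e<..<e} \<gamma> \<and> \<gamma> ` {-e<..<e} \<subseteq> M \<and>
     \<gamma> 0 = p \<and> (\<gamma> has_vector_derivative v) (at (0::real))}"

definition vector_field :: "'a::real_normed_vector set \<Rightarrow> ('a \<Rightarrow> 'a) \<Rightarrow> bool" where
  "vector_field M X \<longleftrightarrow> smooth_map M X \<and> (\<forall>p\<in>M. X p \<in> tangent_space M p)"

text \<open>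
  The differential of a map defined on \<open>M\<close>. The derivative within \<open>M\<close> is in general not unique
  as a linear map on \<open>'a\<close>, but for a smooth map its values on tangent vectors of \<open>M\<close> are.
\<close>

definition differential ::
    "'a::real_normed_vector set \<Rightarrow> ('a \<Rightarrow> 'b::real_normed_vector) \<Rightarrow> 'a \<Rightarrow> 'a \<Rightarrow> 'b" where
  "differential M f p v = frechet_derivative f (at p within M) v"

text \<open>The Lie bracket of two tangent fields, written in the coordinates of the ambient space.\<close>

definition lie_bracket ::
    "'a::real_normed_vector set \<Rightarrow> ('a \<Rightarrow> 'a) \<Rightarrow> ('a \<Rightarrow> 'a) \<Rightarrow> 'a \<Rightarrow> 'a" where
  "lie_bracket M X Y p = differential M Y p (X p) - differential M X p (Y p)"

section \<open>Levi-Civita connection and totally geodesic submanifolds\<close>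

definition is_connection ::
    "'a::real_normed_vector set \<Rightarrow> (('a \<Rightarrow> 'a) \<Rightarrow> ('a \<Rightarrow> 'a) \<Rightarrow> 'a \<Rightarrow> 'a) \<Rightarrow> bool" where
  "is_connection M D \<longleftrightarrow>
     (\<forall>X Y. vector_field M X \<longrightarrow> vector_field M Y \<longrightarrow> vector_field M (D X Y)) \<and>
     (\<forall>X X' Y. vector_field M X \<longrightarrow> vector_field M X' \<longrightarrow> vector_field M Y \<longrightarrow>
        (\<forall>p\<in>M. D (\<lambda>x. X x + X' x) Y p = D X Y p + D X' Y p)) \<and>
     (\<forall>f X Y. smooth_map M f \<longrightarrow> vector_field M X \<longrightarrow> vector_field M Y \<longrightarrow>
        (\<forall>p\<in>M. D (\<lambda>x. f x *\<^sub>R X x) Y p = f p *\<^sub>R D X Y p)) \<and>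
     (\<forall>X Y Y'. vector_field M X \<longrightarrow> vector_field M Y \<longrightarrow> vector_field M Y' \<longrightarrow>
        (\<forall>p\<in>M. D X (\<lambda>x. Y x + Y' x) p = D X Y p + D X Y' p)) \<and>
     (\<forall>f X Y. smooth_map M f \<longrightarrow> vector_field M X \<longrightarrow> vector_field M Y \<longrightarrow>
        (\<forall>p\<in>M. D X (\<lambda>x. f x *\<^sub>R Y x) p
           = f p *\<^sub>R D X Y p + differential M f p (X p) *\<^sub>R Y p))"

definition is_levi_civita ::
    "'a::real_normed_vector set \<Rightarrow> ('a \<Rightarrow> 'a \<Rightarrow> 'a \<Rightarrow> real) \<Rightarrow>
     (('a \<Rightarrow> 'a) \<Rightarrow> ('a \<Rightarrow> 'a) \<Rightarrow> 'a \<Rightarrow> 'a) \<Rightarrow> bool" where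
  "is_levi_civita M g D \<longleftrightarrow> is_connection M D \<and>
     (\<forall>X Y Z. vector_field M X \<longrightarrow> vector_field M Y \<longrightarrow> vector_field M Z \<longrightarrow>
        (\<forall>p\<in>M. differential M (\<lambda>x. g x (Y x) (Z x)) p (X p)
           = g p (D X Y p) (Z p) + g p (Y p) (D X Z p))) \<and>
     (\<forall>X Y. vector_field M X \<longrightarrow> vector_field M Y \<longrightarrow>
        (\<forall>p\<in>M. D X Y p - D Y X p = lie_bracket M X Y p))"

text \<open>
  The choice only affects values off \<open>M\<close> and arguments that are not vector fields on \<open>M\<close>.
\<close>

definition levi_civita ::
    "'a::real_normed_vector set \<Rightarrow> ('a \<Rightarrow> 'a \<Rightarrow> 'a \<Rightarrow> real) \<Rightarrow>
     ('a \<Rightarrow> 'a) \<Rightarrow> ('a \<Rightarrow> 'a) \<Rightarrow> 'a \<Rightarrow> 'a" where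
  "levi_civita M g = (SOME D. is_levi_civita M g D)"

text \<open>
  Vanishing of the second fundamental form, i.e. of the normal component of \<open>\<nabla>\<^sub>X Y\<close>, for fields
  \<open>X\<close>, \<open>Y\<close> of the ambient manifold \<open>M\<close> that are tangent to \<open>N\<close> along \<open>N\<close>.
\<close>

definition totally_geodesic_submanifold ::
    "'a::real_normed_vector set \<Rightarrow> ('a \<Rightarrow> 'a \<Rightarrow> 'a \<Rightarrow> real) \<Rightarrow> 'a set \<Rightarrow> bool" where
  "totally_geodesic_submanifold M g N \<longleftrightarrow> N \<subseteq> M \<and>
     (\<forall>X Y. vector_field M X \<longrightarrow> vector_field M Y \<longrightarrow>
        (\<forall>p\<in>N. X p \<in> tangent_space N p \<and> Y p \<in> tangent_space N p) \<longrightarrow>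
        (\<forall>p\<in>N. levi_civita M g X Y p \<in> tangent_space N p))"

section \<open>Tangent bundle and Sasaki metric\<close>

definition tangent_bundle :: "'a::real_normed_vector set \<Rightarrow> ('a \<times> 'a) set" where
  "tangent_bundle M = {(q, v). q \<in> M \<and> v \<in> tangent_space M q}"

definition unit_tangent_bundle ::
    "'a::real_normed_vector set \<Rightarrow> ('a \<Rightarrow> 'a \<Rightarrow> 'a \<Rightarrow> real) \<Rightarrow> ('a \<times> 'a) set" where
  "unit_tangent_bundle M g = {(q, v) \<in> tangent_bundle M. g q v v = 1}"

text \<open>
  The horizontal lift of \<open>X\<close> to \<open>(q, v)\<close> is the image of \<open>X\<close> under the differential of any section
  \<open>V\<close> through \<open>(q, v)\<close> with \<open>(\<nabla>\<^sub>X V) q = 0\<close>; the field \<open>W\<close> extends \<open>X\<close>. The vertical lift is the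
  velocity of \<open>t \<mapsto> (q, v + t X)\<close>.
\<close>

definition hlift ::
    "'a::real_normed_vector set \<Rightarrow> ('a \<Rightarrow> 'a \<Rightarrow> 'a \<Rightarrow> real) \<Rightarrow> 'a \<times> 'a \<Rightarrow> 'a \<Rightarrow> 'a \<times> 'a" where
  "hlift M g Q X = (THE H. \<exists>V W. vector_field M V \<and> vector_field M W \<and>
     V (fst Q) = snd Q \<and> W (fst Q) = X \<and> levi_civita M g W V (fst Q) = 0 \<and>
     H = (X, differential M V (fst Q) X))"

definition vlift :: "'a::real_normed_vector \<times> 'a \<Rightarrow> 'a \<Rightarrow> 'a \<times> 'a" where
  "vlift Q X = (0, X)"

text \<open>
  A tangent vector \<open>A\<close> of the tangent bundle at \<open>Q\<close> decomposes as
  \<open>A = hlift M g Q (hcomp A) + vlift Q (vcomp M g Q A)\<close>; \<open>hcomp\<close> is the differential of the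
  bundle projection and \<open>vcomp\<close> the connection map.
\<close>

definition hcomp :: "'a::real_normed_vector \<times> 'a \<Rightarrow> 'a" where
  "hcomp A = fst A"

definition vcomp ::
    "'a::real_normed_vector set \<Rightarrow> ('a \<Rightarrow> 'a \<Rightarrow> 'a \<Rightarrow> real) \<Rightarrow> 'a \<times> 'a \<Rightarrow> 'a \<times> 'a \<Rightarrow> 'a" where
  "vcomp M g Q A = snd (A - hlift M g Q (hcomp A))"

definition sasaki_metric ::
    "'a::real_normed_vector set \<Rightarrow> ('a \<Rightarrow> 'a \<Rightarrow> 'a \<Rightarrow> real) \<Rightarrow>
     'a \<times> 'a \<Rightarrow> 'a \<times> 'a \<Rightarrow> 'a \<times> 'a \<Rightarrow> real" where
  "sasaki_metric M g Q A B =
     g (fst Q) (hcomp A) (hcomp B) + g (fst Q) (vcomp M g Q A) (vcomp M g Q B)"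

definition complex_structure ::
    "'a::real_normed_vector set \<Rightarrow> ('a \<Rightarrow> 'a \<Rightarrow> 'a \<Rightarrow> real) \<Rightarrow>
     'a \<times> 'a \<Rightarrow> 'a \<times> 'a \<Rightarrow> 'a \<times> 'a" where
  "complex_structure M g Q A = vlift Q (hcomp A) - hlift M g Q (vcomp M g Q A)"

text \<open>
  The component \<open>\<phi> A\<close> of \<open>J A = \<phi> A + \<eta>(A) \<xi>\<^sup>v\<close> tangent to the unit tangent bundle, where
  \<open>Q = (q, \<xi>)\<close>. Rescaling the Sasaki metric by \<open>1/4\<close> to the contact metric does not affect it.
\<close>

definition contact_phi ::
    "'a::real_normed_vector set \<Rightarrow> ('a \<Rightarrow> 'a \<Rightarrow> 'a \<Rightarrow> real) \<Rightarrow>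
     'a \<times> 'a \<Rightarrow> 'a \<times> 'a \<Rightarrow> 'a \<times> 'a" where
  "contact_phi M g Q A = (THE B. B \<in> tangent_space (unit_tangent_bundle M g) Q \<and>
     (\<exists>\<eta>::real. complex_structure M g Q A = B + \<eta> *\<^sub>R vlift Q (snd Q)))"

section \<open>Unit vector fields\<close>

definition unit_vector_field ::
    "'a::real_normed_vector set \<Rightarrow> ('a \<Rightarrow> 'a \<Rightarrow> 'a \<Rightarrow> real) \<Rightarrow> ('a \<Rightarrow> 'a) \<Rightarrow> bool" where
  "unit_vector_field M g \<xi> \<longleftrightarrow> vector_field M \<xi> \<and> (\<forall>p\<in>M. g p (\<xi> p) (\<xi> p) = 1)"

definition geodesic_field ::
    "'a::real_normed_vector set \<Rightarrow> ('a \<Rightarrow> 'a \<Rightarrow> 'a \<Rightarrow> real) \<Rightarrow> ('a \<Rightarrow> 'a) \<Rightarrow> bool" where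
  "geodesic_field M g \<xi> \<longleftrightarrow> (\<forall>p\<in>M. levi_civita M g \<xi> \<xi> p = 0)"

text \<open>\<open>nabla_A M g \<xi> X Y\<close> is \<open>(\<nabla>\<^sub>X A\<^sub>\<xi>) Y\<close> for \<open>A\<^sub>\<xi> X = - \<nabla>\<^sub>X \<xi>\<close>.\<close>

definition nabla_A ::
    "'a::real_normed_vector set \<Rightarrow> ('a \<Rightarrow> 'a \<Rightarrow> 'a \<Rightarrow> real) \<Rightarrow>
     ('a \<Rightarrow> 'a) \<Rightarrow> ('a \<Rightarrow> 'a) \<Rightarrow> ('a \<Rightarrow> 'a) \<Rightarrow> 'a \<Rightarrow> 'a" where
  "nabla_A M g \<xi> X Y p =
     - (levi_civita M g X (levi_civita M g Y \<xi>) p - levi_civita M g (levi_civita M g X Y) \<xi> p)"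

definition strongly_normal ::
    "'a::real_normed_vector set \<Rightarrow> ('a \<Rightarrow> 'a \<Rightarrow> 'a \<Rightarrow> real) \<Rightarrow> ('a \<Rightarrow> 'a) \<Rightarrow> bool" where
  "strongly_normal M g \<xi> \<longleftrightarrow>
     (\<forall>X Y Z. vector_field M X \<longrightarrow> vector_field M Y \<longrightarrow> vector_field M Z \<longrightarrow>
        (\<forall>p\<in>M. g p (X p) (\<xi> p) = 0 \<and> g p (Y p) (\<xi> p) = 0 \<and> g p (Z p) (\<xi> p) = 0) \<longrightarrow>
        (\<forall>p\<in>M. g p (nabla_A M g \<xi> X Y p) (Z p) = 0))"

definition field_image :: "'a set \<Rightarrow> ('a \<Rightarrow> 'a) \<Rightarrow> ('a \<times> 'a) set" where
  "field_image M \<xi> = (\<lambda>q. (q, \<xi> q)) ` M"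

definition totally_geodesic_field ::
    "'a::real_normed_vector set \<Rightarrow> ('a \<Rightarrow> 'a \<Rightarrow> 'a \<Rightarrow> real) \<Rightarrow> ('a \<Rightarrow> 'a) \<Rightarrow> bool" where
  "totally_geodesic_field M g \<xi> \<longleftrightarrow>
     totally_geodesic_submanifold (unit_tangent_bundle M g) (sasaki_metric M g) (field_image M \<xi>)"

definition invariant_field ::
    "'a::real_normed_vector set \<Rightarrow> ('a \<Rightarrow> 'a \<Rightarrow> 'a \<Rightarrow> real) \<Rightarrow> ('a \<Rightarrow> 'a) \<Rightarrow> bool" where
  "invariant_field M g \<xi> \<longleftrightarrow>
     (\<forall>p\<in>field_image M \<xi>. contact_phi M g p ` tangent_space (field_image M \<xi>) p
        \<subseteq> tangent_space (field_image M \<xi>) p)"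

section \<open>The round sphere\<close>

abbreviation unit_sphere :: "'a::real_inner set" where
  "unit_sphere \<equiv> sphere 0 1"

definition round_metric :: "'a::real_inner \<Rightarrow> 'a \<Rightarrow> 'a \<Rightarrow> real" where
  "round_metric p v w = v \<bullet> w"

end

(* On the image of xi the tangent vectors are the lifts X^h + (B X)^v with B X = nabla_X xi. By the
   formulas for the connection of the Sasaki metric, and since the curvature of the sphere is constant,
   the second fundamental form of the image vanishes iff, modulo xi,
     (nabla_X B) Y = 1/2 (eta(Y) X - eta(X) Y) - 1/2 (eta(X) B^2 Y + eta(Y) B^2 X),
   where eta = <., xi>. For X, Y orthogonal to xi this is strong normality. For Y = xi the left side
   is - B^2 X because nabla_xi xi = 0, so the condition reads B^2 X = - X on the complement of xi;
   this is invariance of the field, and it makes B a complex structure on an n-dimensional space, so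
   n is even. Conversely the case X = xi follows from Y = xi by the symmetry of second derivatives. *)
theory Submission
  imports Defs
begin

section \<open>Calculus of smooth maps\<close>

text \<open>\<open>levi_civita\<close> is a \<open>SOME\<close>, opaque until an explicit connection
  is exhibited and shown to be the only one. Both connections are therefore written in ambient
  coordinates, as flat derivative plus a bilinear correction: the Gauss formula on the sphere,
  \<open>sasaki_christoffel\<close> on its unit tangent bundle. The 1/2 of the condition is the
  factor of the curvature terms there; constant curvature turns these into inner products with xi.
  In place of nabla B the proof uses \<open>hess\<close>, the ambient second derivative of xi. Its
  part tangent to the sphere is (nabla_X B) Y - eta(Y) X. Since (nabla_X B) Y - (nabla_Y B) X is the
  curvature R(X,Y) xi = eta(Y) X - eta(X) Y, the subtracted term is what makes \<open>hess\<close>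
  symmetric. Its components along the base point and along xi are forced by the constraints on xi
  and always fit the condition, so only the complement of both carries information. For Y = xi and X
  orthogonal to xi, \<open>hess\<close> is -(X + B^2 X), while the other terms contribute one half
  of X + B^2 X; the factors differ, so X + B^2 X must vanish.\<close>

lemma Ck_on_cong:
  assumes "open U" "\<And>x. x \<in> U \<Longrightarrow> f x = g x" "Ck_on k U f"
  shows "Ck_on k U g"
  using assms(2,3)
proof (induction k arbitrary: f g)
  case 0
  then show ?case
    using continuous_on_cong by (metis Ck_on.simps(1))
next
  case (Suc k)
  \<comment> \<open>\<open>frechet_derivative\<close> at a point looks at a whole neighbourhood;
    \<open>open U\<close> makes agreement on \<open>U\<close> agreement near the point.\<close>
  have der: "(g has_derivative frechet_derivative f (at x)) (at x)" if "x \<in> U" for x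
    using Suc.prems that assms(1)
    by (metis Ck_on.simps(2) frechet_derivative_works has_derivative_transform_within_open)
  then have eq: "frechet_derivative g (at x) = frechet_derivative f (at x)" if "x \<in> U" for x
    using that frechet_derivative_at by metis
  have "Ck_on k U (\<lambda>x. frechet_derivative g (at x) v)" for v
    by (rule Suc.IH[of "\<lambda>x. frechet_derivative f (at x) v"]) (use eq Suc.prems in auto)
  with der show ?case
    by (auto simp: differentiable_def)
qed

text \<open>\<open>frechet_derivative\<close> is a choice. With this rule the closure lemmas can
  work with whatever derivative the calculus rules produce.\<close>

lemma Ck_on_SucI:
  assumes "open U" "\<And>x. x \<in> U \<Longrightarrow> (f has_derivative f' x) (at x)"
    and "\<And>v. Ck_on k U (\<lambda>x. f' x v)"
  shows "Ck_on (Suc k) U f"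
proof -
  have "Ck_on k U (\<lambda>x. frechet_derivative f (at x) v)" for v
    by (rule Ck_on_cong[OF assms(1) _ assms(3)[of v]])
      (metis assms(2) frechet_derivative_at)
  with assms(2) show ?thesis
    by (auto simp: differentiable_def)
qed

lemma Ck_on_SucD:
  assumes "Ck_on (Suc k) U f" "x \<in> U"
  shows "(f has_derivative frechet_derivative f (at x)) (at x)"
  using assms frechet_derivative_works by auto

lemma Ck_on_subset:
  assumes "Ck_on k U f" "V \<subseteq> U"
  shows "Ck_on k V f"
  using assms by (induction k arbitrary: f) (auto intro: continuous_on_subset)

lemma Ck_on_Suc_imp:
  assumes "Ck_on (Suc k) U f"
  shows "Ck_on k U f"
  using assms
proof (induction k arbitrary: f)
  case 0
  then show ?case
    by (simp add: continuous_at_imp_continuous_on differentiable_imp_continuous_within)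
qed auto

lemma Ck_on_const: "Ck_on k U (\<lambda>x. c)"
proof (induction k arbitrary: c)
  case (Suc k)
  have "frechet_derivative (\<lambda>x. c) (at x) = (\<lambda>v. 0)" for x :: 'a
    by (metis frechet_derivative_at has_derivative_const)
  with Suc show ?case by simp
qed simp

lemma Ck_on_bounded_linear:
  assumes "open U" "bounded_linear h" "Ck_on k U f"
  shows "Ck_on k U (\<lambda>x. h (f x))"
  using assms(3)
proof (induction k arbitrary: f)
  case 0
  then show ?case
    using assms(2) by (simp add: bounded_linear.continuous_on)
next
  case (Suc k)
  show ?case
    by (rule Ck_on_SucI[OF assms(1)],
        rule bounded_linear.has_derivative[OF assms(2)], erule Ck_on_SucD[OF Suc.prems],
        rule Suc.IH) (use Suc.prems in auto)
qed

lemma Ck_on_id: "open U \<Longrightarrow> Ck_on k U (\<lambda>x. x)"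
proof (cases k)
  case (Suc m)
  assume "open U"
  then show ?thesis
    unfolding Suc by (rule Ck_on_SucI[where f' = "\<lambda>x v. v"]) (auto intro: Ck_on_const)
qed simp

lemma Ck_on_add:
  assumes "open U" "Ck_on k U f" "Ck_on k U g"
  shows "Ck_on k U (\<lambda>x. f x + g x)"
  using assms(2,3)
proof (induction k arbitrary: f g)
  case 0
  then show ?case by (simp add: continuous_on_add)
next
  case (Suc k)
  show ?case
    by (rule Ck_on_SucI[OF assms(1)], rule has_derivative_add,
        erule Ck_on_SucD[OF Suc.prems(1)], erule Ck_on_SucD[OF Suc.prems(2)],
        rule Suc.IH) (use Suc.prems in auto)
qed

lemma Ck_on_sum:
  assumes "open U" "finite I" "\<And>i. i \<in> I \<Longrightarrow> Ck_on k U (f i)"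
  shows "Ck_on k U (\<lambda>x. \<Sum>i\<in>I. f i x)"
  using assms(2,3) by (induction I) (auto intro: Ck_on_const Ck_on_add[OF assms(1)])

lemma Ck_on_bilinear:
  assumes "open U" "bounded_bilinear h" "Ck_on k U f" "Ck_on k U g"
  shows "Ck_on k U (\<lambda>x. h (f x) (g x))"
  using assms(3,4)
proof (induction k arbitrary: f g)
  case 0
  then show ?case
    using bounded_bilinear.continuous_on[OF assms(2)] by auto
next
  case (Suc k)
  \<comment> \<open>The product rule leaves one factor undifferentiated, so order \<open>k\<close>
    of \<open>f\<close> and \<open>g\<close> themselves is needed beside that of their
    derivatives.\<close>
  have "Ck_on k U f" "Ck_on k U g"
    using Suc.prems Ck_on_Suc_imp by blast+
  with Suc.prems show ?case
    by (intro Ck_on_SucI[OF assms(1)])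
      (rule bounded_bilinear.FDERIV[OF assms(2)],
        erule Ck_on_SucD[OF Suc.prems(1)], erule Ck_on_SucD[OF Suc.prems(2)],
        intro Ck_on_add[OF assms(1)] Suc.IH, auto)
qed

text \<open>\<open>Ck_on\<close> speaks of derivatives in fixed directions only. Expanding in
  \<open>Basis\<close> reduces a direction that moves with the point to finitely many fixed
  ones.\<close>

lemma frechet_derivative_sum_Basis:
  assumes "(f has_derivative f') (at x)"
  shows "f' v = (\<Sum>b\<in>Basis. (v \<bullet> b) *\<^sub>R f' b)"
  using linear_sum[OF has_derivative_linear[OF assms], of "\<lambda>b. (v \<bullet> b) *\<^sub>R b" Basis]
  by (simp add: euclidean_representation linear_cmul[OF has_derivative_linear[OF assms]])

lemma Ck_on_compose:
  fixes f :: "'b::euclidean_space \<Rightarrow> 'c::real_normed_vector"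
  assumes "open U" "open V" "Ck_on k V f" "Ck_on k U g" "g ` U \<subseteq> V"
  shows "Ck_on k U (\<lambda>x. f (g x))"
  using assms(3,4)
proof (induction k arbitrary: f)
  case 0
  then show ?case
    using continuous_on_compose2 assms(5) by auto
next
  case (Suc k)
  let ?f' = "\<lambda>y. frechet_derivative f (at y)" and ?g' = "\<lambda>x. frechet_derivative g (at x)"
  have 1: "((\<lambda>x. f (g x)) has_derivative (\<lambda>v. ?f' (g x) (?g' x v))) (at x)" if "x \<in> U" for x
    using has_derivative_compose[OF Ck_on_SucD[OF Suc.prems(2) that]]
      Ck_on_SucD[OF Suc.prems(1)] assms(5) that by blast
  \<comment> \<open>The direction \<open>?g' x v\<close> of the chain rule depends on
    \<open>x\<close>. After expansion in \<open>Basis\<close> there remain products of compositions,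
    to which the induction hypothesis applies.\<close>
  have 2: "Ck_on k U (\<lambda>x. \<Sum>b\<in>Basis. (?g' x v \<bullet> b) *\<^sub>R ?f' (g x) b)" for v
    using Suc.prems Ck_on_Suc_imp[OF Suc.prems(2)]
    by (intro Ck_on_sum Ck_on_bilinear[OF _ bounded_bilinear_scaleR] assms(1)
        Ck_on_bounded_linear[OF _ bounded_linear_inner_left] Suc.IH) auto
  have 3: "Ck_on k U (\<lambda>x. ?f' (g x) (?g' x v))" for v
    by (rule Ck_on_cong[OF assms(1) _ 2[of v]])
      (use frechet_derivative_sum_Basis[OF Ck_on_SucD[OF Suc.prems(1)]] assms(5) in force)
  show ?case
    by (rule Ck_on_SucI[OF assms(1) 1 3])
qed

text \<open>The exponent is arbitrary because differentiation lowers it. The case of use is -1/2,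
  for normalising vectors.\<close>

lemma Ck_on_powr: "Ck_on k {0<..} (\<lambda>s::real. s powr r)"
proof (induction k arbitrary: r)
  case 0
  show ?case by (auto intro!: continuous_intros)
next
  case (Suc k)
  have "((\<lambda>s. s powr r) has_derivative (\<lambda>v. v * (r * s powr (r - 1)))) (at s)" if "s \<in> {0<..}" for s
    using has_real_derivative_powr[of s r] that
    by (simp add: has_field_derivative_def mult.commute[of _ "_ * _"])
  moreover have "Ck_on k {0<..} (\<lambda>s. v * (r * s powr (r - 1)))" for v
    using Ck_on_bounded_linear[OF _ bounded_linear_mult_right Suc.IH, of "v * r"]
    by (simp add: mult.assoc)
  ultimately show ?case
    by (intro Ck_on_SucI) auto
qed

lemma Ck_on_Pair:
  assumes "open U" "Ck_on k U f" "Ck_on k U g"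
  shows "Ck_on k U (\<lambda>x. (f x, g x))"
  using Ck_on_add[OF assms(1)
      Ck_on_bounded_linear[OF assms(1) bounded_linear_Pair[OF bounded_linear_ident bounded_linear_zero] assms(2)]
      Ck_on_bounded_linear[OF assms(1) bounded_linear_Pair[OF bounded_linear_zero bounded_linear_ident] assms(3)]]
  by simp

section \<open>Smooth functions on open sets\<close>

lemma smooth_on_frechet:
  assumes "smooth_on U f"
  shows "smooth_on U (\<lambda>x. frechet_derivative f (at x) v)"
  using assms unfolding smooth_on_def by (metis Ck_on.simps(2))

lemma smooth_on_has_derivative:
  assumes "smooth_on U f" "x \<in> U"
  shows "(f has_derivative frechet_derivative f (at x)) (at x)"
  using assms Ck_on_SucD unfolding smooth_on_def by blast

lemma smooth_on_continuous: "smooth_on U f \<Longrightarrow> continuous_on U f"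
  unfolding smooth_on_def by (metis Ck_on.simps(1))

lemma smooth_on_subset: "smooth_on U f \<Longrightarrow> V \<subseteq> U \<Longrightarrow> smooth_on V f"
  unfolding smooth_on_def using Ck_on_subset by blast

lemma smooth_on_compose:
  fixes f :: "'b::euclidean_space \<Rightarrow> 'c::real_normed_vector"
  assumes "smooth_on V f" "smooth_on U g" "open U" "open V" "g ` U \<subseteq> V"
  shows "smooth_on U (\<lambda>x. f (g x))"
  using assms Ck_on_compose unfolding smooth_on_def by blast

lemma smooth_on_bounded_linear:
  "open U \<Longrightarrow> bounded_linear h \<Longrightarrow> smooth_on U f \<Longrightarrow> smooth_on U (\<lambda>x. h (f x))"
  unfolding smooth_on_def using Ck_on_bounded_linear by blast

lemma smooth_on_bilinear:
  "open U \<Longrightarrow> bounded_bilinear h \<Longrightarrow> smooth_on U f \<Longrightarrow> smooth_on U g \<Longrightarrow> smooth_on U (\<lambda>x. h (f x) (g x))"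
  unfolding smooth_on_def using Ck_on_bilinear by blast

lemma smooth_on_Pair:
  "open U \<Longrightarrow> smooth_on U f \<Longrightarrow> smooth_on U g \<Longrightarrow> smooth_on U (\<lambda>x. (f x, g x))"
  unfolding smooth_on_def using Ck_on_Pair by blast

lemma smooth_on_add:
  "open U \<Longrightarrow> smooth_on U f \<Longrightarrow> smooth_on U g \<Longrightarrow> smooth_on U (\<lambda>x. f x + g x)"
  unfolding smooth_on_def using Ck_on_add by blast

lemma smooth_on_const: "smooth_on U (\<lambda>x. c)"
  unfolding smooth_on_def using Ck_on_const by blast

lemma smooth_on_id: "open U \<Longrightarrow> smooth_on U (\<lambda>x. x)"
  unfolding smooth_on_def using Ck_on_id by blast

lemma smooth_on_powr: "smooth_on {0<..} (\<lambda>s::real. s powr r)"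
  unfolding smooth_on_def using Ck_on_powr by blast

text \<open>Both mixed derivatives are limits of the same second difference quotient.\<close>

lemma second_difference_mvt:
  fixes f :: "'a::real_normed_vector \<Rightarrow> real"
  assumes f: "\<And>y. y \<in> ball x r \<Longrightarrow> (f has_derivative f' y) (at y)"
    and fa: "\<And>y. y \<in> ball x r \<Longrightarrow> ((\<lambda>z. f' z a) has_derivative f'' y) (at y)"
    and t: "0 < t" "t * (norm a + norm b) < r"
  shows "\<exists>y. dist x y \<le> t * (norm a + norm b) \<and>
    f (x + t *\<^sub>R a + t *\<^sub>R b) - f (x + t *\<^sub>R a) - f (x + t *\<^sub>R b) + f x = t\<^sup>2 * f'' y b"
proof -
  have nrm: "norm (s *\<^sub>R a + u *\<^sub>R b) \<le> t * (norm a + norm b)"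
    if "0 \<le> s" "s \<le> t" "0 \<le> u" "u \<le> t" for s u
  proof -
    have "norm (s *\<^sub>R a + u *\<^sub>R b) \<le> s * norm a + u * norm b"
      using norm_triangle_ineq[of "s *\<^sub>R a" "u *\<^sub>R b"] that by simp
    also have "\<dots> \<le> t * norm a + t * norm b"
      using that by (intro add_mono mult_right_mono) auto
    finally show ?thesis by (simp add: algebra_simps)
  qed
  have dst: "dist x (x + s *\<^sub>R a + u *\<^sub>R b) \<le> t * (norm a + norm b)"
    if "0 \<le> s" "s \<le> t" "0 \<le> u" "u \<le> t" for s u
  proof -
    have "dist x (x + s *\<^sub>R a + u *\<^sub>R b) = norm (s *\<^sub>R a + u *\<^sub>R b)"
      using dist_add_cancel[of x 0 "s *\<^sub>R a + u *\<^sub>R b"] by (simp add: add.assoc)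
    with nrm[OF that] show ?thesis by simp
  qed
  have inb: "x + s *\<^sub>R a + u *\<^sub>R b \<in> ball x r"
    if "0 \<le> s" "s \<le> t" "0 \<le> u" "u \<le> t" for s u
    using dst[OF that] t by simp
  \<comment> \<open>The second difference is the increment of \<open>\<phi>\<close> over [0, t]. The
    mean value theorem makes it \<open>t\<close> times an increment of \<open>f' _ a\<close> in
    direction \<open>b\<close>, namely that of \<open>\<psi>\<close>, to which the theorem is
    applied once more.\<close>
  define \<phi> where "\<phi> s = f (x + s *\<^sub>R a + t *\<^sub>R b) - f (x + s *\<^sub>R a)" for s
  have d\<phi>: "(\<phi> has_real_derivative (f' (x + s *\<^sub>R a + t *\<^sub>R b) a - f' (x + s *\<^sub>R a) a)) (at s)"
    if "0 \<le> s" "s \<le> t" for s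
  proof -
    have 1: "x + s *\<^sub>R a + t *\<^sub>R b \<in> ball x r" "x + s *\<^sub>R a \<in> ball x r"
      using inb[of s t] inb[of s 0] that t by auto
    have 2: "((\<lambda>s. x + s *\<^sub>R a + t *\<^sub>R b) has_derivative (\<lambda>h. h *\<^sub>R a)) (at s)"
      "((\<lambda>s. x + s *\<^sub>R a) has_derivative (\<lambda>h. h *\<^sub>R a)) (at s)"
      by (auto intro!: derivative_eq_intros)
    show ?thesis
      unfolding \<phi>_def has_field_derivative_def
      using has_derivative_diff[OF has_derivative_compose[OF 2(1) f[OF 1(1)]]
          has_derivative_compose[OF 2(2) f[OF 1(2)]]]
      by (rule has_derivative_eq_rhs)
        (auto simp: fun_eq_iff right_diff_distrib mult.commute linear_cmul[OF has_derivative_linear[OF f[OF 1(1)]]]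
          linear_cmul[OF has_derivative_linear[OF f[OF 1(2)]]])
  qed
  obtain s where s: "0 < s" "s < t"
    "\<phi> t - \<phi> 0 = t * (f' (x + s *\<^sub>R a + t *\<^sub>R b) a - f' (x + s *\<^sub>R a) a)"
    using MVT2[OF t(1) d\<phi>] by auto
  define \<psi> where "\<psi> u = f' (x + s *\<^sub>R a + u *\<^sub>R b) a" for u
  have d\<psi>: "(\<psi> has_real_derivative (f'' (x + s *\<^sub>R a + u *\<^sub>R b) b)) (at u)"
    if "0 \<le> u" "u \<le> t" for u
  proof -
    have 1: "x + s *\<^sub>R a + u *\<^sub>R b \<in> ball x r"
      using inb[of s u] that s by auto
    have 2: "((\<lambda>u. x + s *\<^sub>R a + u *\<^sub>R b) has_derivative (\<lambda>h. h *\<^sub>R b)) (at u)"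
      by (auto intro!: derivative_eq_intros)
    show ?thesis
      unfolding \<psi>_def has_field_derivative_def
      using has_derivative_compose[OF 2 fa[OF 1]]
      by (rule has_derivative_eq_rhs)
        (auto simp: fun_eq_iff linear_cmul[OF has_derivative_linear[OF fa[OF 1]]])
  qed
  obtain u where u: "0 < u" "u < t" "\<psi> t - \<psi> 0 = t * f'' (x + s *\<^sub>R a + u *\<^sub>R b) b"
    using MVT2[OF t(1) d\<psi>] by auto
  have "f (x + t *\<^sub>R a + t *\<^sub>R b) - f (x + t *\<^sub>R a) - f (x + t *\<^sub>R b) + f x = \<phi> t - \<phi> 0"
    by (simp add: \<phi>_def)
  also have "\<dots> = t\<^sup>2 * f'' (x + s *\<^sub>R a + u *\<^sub>R b) b"
    using s(3) u(3) by (simp add: \<psi>_def power2_eq_square)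
  finally show ?thesis
    using dst[of s u] s u by (metis less_imp_le)
qed

text \<open>The mean value point stays within \<open>t * (norm a + norm b)\<close> of
  \<open>x\<close>, and the second derivative is continuous there.\<close>

lemma second_difference_tendsto:
  fixes f :: "'a::real_normed_vector \<Rightarrow> real"
  assumes "open U" "x \<in> U" and f: "smooth_on U f"
  shows "((\<lambda>t. (f (x + t *\<^sub>R a + t *\<^sub>R b) - f (x + t *\<^sub>R a) - f (x + t *\<^sub>R b) + f x) / t\<^sup>2) \<longlongrightarrow>
    frechet_derivative (\<lambda>y. frechet_derivative f (at y) a) (at x) b) (at_right 0)"
proof -
  let ?f' = "\<lambda>y. frechet_derivative f (at y)"
  let ?g = "\<lambda>y. frechet_derivative (\<lambda>z. ?f' z a) (at y) b"
  let ?q = "\<lambda>t. (f (x + t *\<^sub>R a + t *\<^sub>R b) - f (x + t *\<^sub>R a) - f (x + t *\<^sub>R b) + f x) / t\<^sup>2"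
  obtain r where r: "r > 0" "ball x r \<subseteq> U"
    using assms openE by blast
  have cont: "isCont ?g x"
    using smooth_on_continuous[OF smooth_on_frechet[OF smooth_on_frechet[OF f]]] assms(1,2)
      continuous_on_eq_continuous_at by blast
  have f1: "(f has_derivative ?f' y) (at y)" if "y \<in> ball x r" for y
    using smooth_on_has_derivative[OF f] r that by blast
  have f2: "((\<lambda>z. ?f' z a) has_derivative frechet_derivative (\<lambda>z. ?f' z a) (at y)) (at y)"
    if "y \<in> ball x r" for y
    using smooth_on_has_derivative[OF smooth_on_frechet[OF f]] r that by blast
  show ?thesis
  proof (rule tendstoI)
    fix e :: real assume "e > 0"
    with cont obtain d where d: "d > 0" "\<And>y. dist y x < d \<Longrightarrow> dist (?g y) (?g x) < e"
      unfolding continuous_at_eps_delta by (metis dist_norm)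
    \<comment> \<open>The summand 1 keeps \<open>K\<close> positive when \<open>a\<close> and
      \<open>b\<close> are both 0, so that \<open>\<delta>\<close> is positive.\<close>
    define K where "K = norm a + norm b + 1"
    have "K > 0" by (simp add: K_def add_nonneg_pos)
    define \<delta> where "\<delta> = min r d / K"
    have "\<delta> > 0" using r d \<open>K > 0\<close> by (simp add: \<delta>_def)
    have "dist (?q t) (?g x) < e" if t: "0 < t" "t < \<delta>" for t
    proof -
      have "t * (norm a + norm b) \<le> t * K" using that by (simp add: K_def)
      also have "t * K < min r d" using that \<open>K > 0\<close> by (simp add: \<delta>_def pos_less_divide_eq)
      finally have lt: "t * (norm a + norm b) < min r d" .
      obtain y where y: "dist x y \<le> t * (norm a + norm b)"
        and "f (x + t *\<^sub>R a + t *\<^sub>R b) - f (x + t *\<^sub>R a) - f (x + t *\<^sub>R b) + f x = t\<^sup>2 * ?g y"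
        using second_difference_mvt[OF f1 f2 t(1)] lt by (metis min_less_iff_conj)
      then have "?q t = ?g y"
        using t by simp
      with d(2)[of y] y lt show ?thesis
        by (simp add: dist_commute)
    qed
    then show "\<forall>\<^sub>F t in at_right 0. dist (?q t) (?g x) < e"
      unfolding eventually_at_right_field using \<open>\<delta> > 0\<close> by blast
  qed
qed

lemma smooth_on_mixed_derivatives_real:
  fixes f :: "'a::real_normed_vector \<Rightarrow> real"
  assumes "open U" "x \<in> U" and f: "smooth_on U f"
  shows "frechet_derivative (\<lambda>y. frechet_derivative f (at y) a) (at x) b =
    frechet_derivative (\<lambda>y. frechet_derivative f (at y) b) (at x) a"
  using second_difference_tendsto[OF assms, of a b] second_difference_tendsto[OF assms, of b a]
  by (intro tendsto_unique[of "at_right (0::real)"]) (auto simp: algebra_simps)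

text \<open>Taken coordinate by coordinate, since the mean value theorem behind the real case has no
  vector-valued form.\<close>

lemma smooth_on_mixed_derivatives:
  fixes f :: "'a::real_normed_vector \<Rightarrow> 'b::euclidean_space"
  assumes "open U" "x \<in> U" and f: "smooth_on U f"
  shows "frechet_derivative (\<lambda>y. frechet_derivative f (at y) a) (at x) b =
    frechet_derivative (\<lambda>y. frechet_derivative f (at y) b) (at x) a"
proof (rule euclidean_eqI)
  fix c :: 'b assume "c \<in> Basis"
  have fc: "smooth_on U (\<lambda>y. f y \<bullet> c)"
    by (rule smooth_on_bounded_linear[OF assms(1) bounded_linear_inner_left f])
  have 1: "frechet_derivative (\<lambda>y. f y \<bullet> c) (at y) v = frechet_derivative f (at y) v \<bullet> c"
    if "y \<in> U" for y v
    using frechet_derivative_at[OF has_derivative_inner_left[OF smooth_on_has_derivative[OF f that], of c]]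
    by (auto simp: fun_eq_iff)
  have 2: "frechet_derivative (\<lambda>y. frechet_derivative (\<lambda>y. f y \<bullet> c) (at y) v) (at x) w =
     frechet_derivative (\<lambda>y. frechet_derivative f (at y) v) (at x) w \<bullet> c" for v w
  proof -
    have "((\<lambda>y. frechet_derivative f (at y) v \<bullet> c) has_derivative
        (\<lambda>w. frechet_derivative (\<lambda>y. frechet_derivative f (at y) v) (at x) w \<bullet> c)) (at x)"
      by (rule has_derivative_inner_left[OF smooth_on_has_derivative[OF smooth_on_frechet[OF f] assms(2)]])
    then have "((\<lambda>y. frechet_derivative (\<lambda>y. f y \<bullet> c) (at y) v) has_derivative
        (\<lambda>w. frechet_derivative (\<lambda>y. frechet_derivative f (at y) v) (at x) w \<bullet> c)) (at x)"
      by (rule has_derivative_transform_within_open[OF _ assms(1,2)]) (simp add: 1)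
    from frechet_derivative_at[OF this] show ?thesis by (auto simp: fun_eq_iff)
  qed
  show "frechet_derivative (\<lambda>y. frechet_derivative f (at y) a) (at x) b \<bullet> c =
    frechet_derivative (\<lambda>y. frechet_derivative f (at y) b) (at x) a \<bullet> c"
    using smooth_on_mixed_derivatives_real[OF assms(1,2) fc, of a b] by (simp add: 2)
qed

section \<open>Smooth maps on arbitrary subsets, through local extensions\<close>

lemma smooth_map_const: "smooth_map M (\<lambda>x. c)"
  unfolding smooth_map_def smooth_on_def using Ck_on_const by blast

lemma smooth_map_id: "smooth_map M (\<lambda>x. x)"
  unfolding smooth_map_def smooth_on_def using Ck_on_id by blast

lemma smooth_map_bounded_linear:
  assumes "bounded_linear h" "smooth_map M f"
  shows "smooth_map M (\<lambda>x. h (f x))"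
  unfolding smooth_map_def
proof
  fix p assume "p \<in> M"
  then obtain U F where "open U" "p \<in> U" "smooth_on U F" "\<And>x. x \<in> M \<inter> U \<Longrightarrow> F x = f x"
    using assms(2) unfolding smooth_map_def by metis
  then show "\<exists>U F. open U \<and> p \<in> U \<and> smooth_on U F \<and> (\<forall>x\<in>M \<inter> U. F x = h (f x))"
    by (intro exI[of _ U] exI[of _ "\<lambda>x. h (F x)"]) (auto intro: smooth_on_bounded_linear[OF _ assms(1)])
qed

lemma smooth_map_common_extension:
  assumes "smooth_map M f" "smooth_map M g" "p \<in> M"
  obtains U F G where "open U" "p \<in> U" "smooth_on U F" "smooth_on U G"
    "\<And>x. x \<in> M \<Longrightarrow> x \<in> U \<Longrightarrow> F x = f x" "\<And>x. x \<in> M \<Longrightarrow> x \<in> U \<Longrightarrow> G x = g x"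
proof -
  obtain U F where "open U" "p \<in> U" "smooth_on U F" "\<And>x. x \<in> M \<inter> U \<Longrightarrow> F x = f x"
    using assms(1,3) unfolding smooth_map_def by metis
  moreover obtain V G where "open V" "p \<in> V" "smooth_on V G" "\<And>x. x \<in> M \<inter> V \<Longrightarrow> G x = g x"
    using assms(2,3) unfolding smooth_map_def by metis
  ultimately show ?thesis
    by (intro that[of "U \<inter> V" F G]) (auto intro: smooth_on_subset)
qed

lemma smooth_map_bilinear:
  assumes "bounded_bilinear h" "smooth_map M f" "smooth_map M g"
  shows "smooth_map M (\<lambda>x. h (f x) (g x))"
  unfolding smooth_map_def
proof
  fix p assume "p \<in> M"
  with assms(2,3) obtain U F G where "open U" "p \<in> U" "smooth_on U F" "smooth_on U G"
    "\<And>x. x \<in> M \<Longrightarrow> x \<in> U \<Longrightarrow> F x = f x" "\<And>x. x \<in> M \<Longrightarrow> x \<in> U \<Longrightarrow> G x = g x"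
    by (rule smooth_map_common_extension) blast
  then show "\<exists>U F. open U \<and> p \<in> U \<and> smooth_on U F \<and> (\<forall>x\<in>M \<inter> U. F x = h (f x) (g x))"
    by (intro exI[of _ U] exI[of _ "\<lambda>x. h (F x) (G x)"]) (auto intro: smooth_on_bilinear[OF _ assms(1)])
qed

lemma smooth_map_Pair:
  assumes "smooth_map M f" "smooth_map M g"
  shows "smooth_map M (\<lambda>x. (f x, g x))"
  unfolding smooth_map_def
proof
  fix p assume "p \<in> M"
  with assms obtain U F G where "open U" "p \<in> U" "smooth_on U F" "smooth_on U G"
    "\<And>x. x \<in> M \<Longrightarrow> x \<in> U \<Longrightarrow> F x = f x" "\<And>x. x \<in> M \<Longrightarrow> x \<in> U \<Longrightarrow> G x = g x"
    by (rule smooth_map_common_extension) blast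
  then show "\<exists>U F. open U \<and> p \<in> U \<and> smooth_on U F \<and> (\<forall>x\<in>M \<inter> U. F x = (f x, g x))"
    by (intro exI[of _ U] exI[of _ "\<lambda>x. (F x, G x)"]) (auto intro: smooth_on_Pair)
qed

lemma smooth_map_add:
  assumes "smooth_map M f" "smooth_map M g"
  shows "smooth_map M (\<lambda>x. f x + g x)"
  using smooth_map_bounded_linear[OF bounded_linear_add[OF bounded_linear_fst bounded_linear_snd]
      smooth_map_Pair[OF assms]] by simp

lemma smooth_map_diff:
  assumes "smooth_map M f" "smooth_map M g"
  shows "smooth_map M (\<lambda>x. f x - g x)"
  using smooth_map_bounded_linear[OF bounded_linear_sub[OF bounded_linear_fst bounded_linear_snd]
      smooth_map_Pair[OF assms]] by simp

lemmas smooth_map_scaleR = smooth_map_bilinear[OF bounded_bilinear_scaleR]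
lemmas smooth_map_inner = smooth_map_bilinear[OF bounded_bilinear_inner]
lemmas smooth_map_mult = smooth_map_bilinear[OF bounded_bilinear_mult]
lemmas smooth_map_fst = smooth_map_bounded_linear[OF bounded_linear_fst]
lemmas smooth_map_snd = smooth_map_bounded_linear[OF bounded_linear_snd]

lemmas smooth_map_intros = smooth_map_const smooth_map_id smooth_map_add smooth_map_diff
  smooth_map_scaleR smooth_map_inner smooth_map_mult smooth_map_fst smooth_map_snd smooth_map_Pair

lemma smooth_map_cong:
  assumes "\<And>x. x \<in> M \<Longrightarrow> f x = g x" "smooth_map M f"
  shows "smooth_map M g"
  using assms unfolding smooth_map_def by (metis IntD1)

lemma smooth_map_compose:
  fixes f :: "'b::euclidean_space \<Rightarrow> 'c::real_normed_vector"
  assumes "smooth_map N f" "smooth_map M g" "g ` M \<subseteq> N"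
  shows "smooth_map M (\<lambda>x. f (g x))"
  unfolding smooth_map_def
proof
  fix p assume p: "p \<in> M"
  obtain U G where U: "open U" "p \<in> U" "smooth_on U G" "\<And>x. x \<in> M \<inter> U \<Longrightarrow> G x = g x"
    using assms(2) p unfolding smooth_map_def by metis
  obtain V F where V: "open V" "g p \<in> V" "smooth_on V F" "\<And>x. x \<in> N \<inter> V \<Longrightarrow> F x = f x"
    using assms(1,3) p unfolding smooth_map_def by (metis image_subset_iff)
  \<comment> \<open>Off \<open>M\<close> the extension \<open>G\<close> may leave \<open>V\<close>;
    on the preimage of \<open>V\<close> the two extensions can be composed.\<close>
  define W where "W = U \<inter> G -` V"
  have W: "open W"
    unfolding W_def
    using continuous_on_open_vimage[OF U(1)] smooth_on_continuous[OF U(3)] V(1) by (metis Int_commute)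
  have "smooth_on W (\<lambda>x. F (G x))"
    by (rule smooth_on_compose[OF V(3) smooth_on_subset[OF U(3)] W V(1)]) (auto simp: W_def)
  moreover have "p \<in> W"
    using p U V by (simp add: W_def)
  moreover have "F (G x) = f (g x)" if "x \<in> M \<inter> W" for x
    using that U(4)[of x] V(4)[of "g x"] assms(3) by (auto simp: W_def)
  ultimately show "\<exists>U F. open U \<and> p \<in> U \<and> smooth_on U F \<and> (\<forall>x\<in>M \<inter> U. F x = f (g x))"
    using W by blast
qed

text \<open>A local extension supplies one derivative within \<open>M\<close>, hence the choice made
  by \<open>differential\<close> is a derivative as well. On vectors not tangent to \<open>M\<close>
  the two may differ.\<close>

lemma smooth_map_has_derivative:
  assumes "smooth_map M f" "p \<in> M"
  shows "(f has_derivative differential M f p) (at p within M)"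
proof -
  obtain U F where U: "open U" "p \<in> U" "smooth_on U F" "\<And>x. x \<in> M \<inter> U \<Longrightarrow> F x = f x"
    using assms unfolding smooth_map_def by metis
  have "(F has_derivative frechet_derivative F (at p)) (at p within M)"
    using smooth_on_has_derivative[OF U(3,2)] has_derivative_at_withinI by blast
  then have "(f has_derivative frechet_derivative F (at p)) (at p within M)"
    by (rule has_derivative_transform_eventually)
      (use U assms(2) in \<open>auto simp: eventually_at_filter eventually_nhds\<close>)
  then show ?thesis
    using frechet_derivative_works unfolding differential_def differentiable_def by blast
qed

section \<open>Tangent vectors\<close>

lemma tangent_spaceI:
  assumes "open U" "0 \<in> U" "smooth_on U \<gamma>" "\<gamma> ` U \<subseteq> M" "\<gamma> 0 = p"
    "(\<gamma> has_vector_derivative v) (at (0::real))"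
  shows "v \<in> tangent_space M p"
proof -
  obtain e where "e > 0" "ball 0 e \<subseteq> U"
    using assms(1,2) openE by blast
  then have "{-e<..<e} \<subseteq> U"
    by (simp add: ball_eq_greaterThanLessThan)
  then show ?thesis
    using assms \<open>e > 0\<close> smooth_on_subset unfolding tangent_space_def by blast
qed

text \<open>Restricting to a curve that represents \<open>v\<close> turns a possibly ambiguous
  derivative within \<open>M\<close> into an ordinary derivative in one real variable.\<close>

lemma tangent_has_derivative:
  assumes "v \<in> tangent_space M p" "(f has_derivative f') (at p within M)"
  obtains \<gamma> where "((\<lambda>t. f (\<gamma> t)) has_vector_derivative f' v) (at 0)"
    "eventually (\<lambda>t. \<gamma> t \<in> M) (nhds 0)" "\<gamma> 0 = p" "(\<gamma> has_vector_derivative v) (at 0)"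
proof -
  obtain \<gamma> e where \<gamma>: "e > 0" "smooth_on {-e<..<e} \<gamma>" "\<gamma> ` {-e<..<e} \<subseteq> M" "\<gamma> 0 = p"
    "(\<gamma> has_vector_derivative v) (at (0::real))"
    using assms(1) unfolding tangent_space_def by blast
  have "((\<lambda>t. f (\<gamma> t)) has_derivative (\<lambda>h. f' (h *\<^sub>R v))) (at 0 within {-e<..<e})"
    by (rule has_derivative_in_compose[OF has_derivative_at_withinI])
      (use \<gamma> assms(2) in \<open>auto simp: has_vector_derivative_def intro: has_derivative_subset\<close>)
  then have "((\<lambda>t. f (\<gamma> t)) has_vector_derivative f' v) (at 0 within {-e<..<e})"
    unfolding has_vector_derivative_def
    by (simp add: linear_cmul[OF has_derivative_linear[OF assms(2)]])
  then have "((\<lambda>t. f (\<gamma> t)) has_vector_derivative f' v) (at 0)"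
    using \<gamma>(1) by (simp add: at_within_open[of 0 "{-e<..<e}"])
  moreover have "eventually (\<lambda>t. \<gamma> t \<in> M) (nhds 0)"
    unfolding eventually_nhds using \<gamma>(1,3) by (intro exI[of _ "{-e<..<e}"]) auto
  ultimately show ?thesis
    using \<gamma> that by blast
qed

text \<open>The function minus itself has the difference of the two derivatives as a derivative
  within \<open>M\<close>; along a curve this is the derivative of a constant.\<close>

lemma has_derivative_unique_tangent:
  assumes "v \<in> tangent_space M p"
    "(f has_derivative f') (at p within M)" "(f has_derivative f'') (at p within M)"
  shows "f' v = f'' v"
proof -
  have "((\<lambda>x. f x - f x) has_derivative (\<lambda>v. f' v - f'' v)) (at p within M)"
    by (rule has_derivative_diff[OF assms(2,3)])
  from tangent_has_derivative[OF assms(1) this]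
  have "((\<lambda>t::real. 0) has_vector_derivative f' v - f'' v) (at 0)"
    by auto
  then show ?thesis
    using vector_derivative_unique_at[OF has_vector_derivative_const[of 0]] by fastforce
qed

text \<open>With this rule the relations that hold on \<open>M\<close>, such as unit length and
  orthogonality, are differentiated throughout.\<close>

lemma has_derivative_tangent_eq_0:
  assumes "v \<in> tangent_space M p" "(f has_derivative f') (at p within M)"
    "\<And>x. x \<in> M \<Longrightarrow> f x = c" "p \<in> M"
  shows "f' v = 0"
proof -
  have "(f has_derivative (\<lambda>v. 0)) (at p within M)"
    by (rule has_derivative_transform[OF assms(4,3) has_derivative_const])
  with assms(1,2) show ?thesis
    using has_derivative_unique_tangent by blast
qed

lemma differential_eq:
  assumes "v \<in> tangent_space M p" "(f has_derivative f') (at p within M)"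
  shows "differential M f p v = f' v"
proof -
  have "(f has_derivative differential M f p) (at p within M)"
    using assms(2) frechet_derivative_works unfolding differential_def differentiable_def by blast
  with assms show ?thesis
    using has_derivative_unique_tangent by blast
qed

lemma differential_cong:
  assumes "v \<in> tangent_space M p" "smooth_map M f" "p \<in> M" "\<And>x. x \<in> M \<Longrightarrow> f x = g x"
  shows "differential M f p v = differential M g p v"
  using differential_eq[OF assms(1)
      has_derivative_transform[OF assms(3) _ smooth_map_has_derivative[OF assms(2,3)], of g]] assms(4)
  by simp

text \<open>The direction \<open>X p\<close> moves with the point, so the local formula is again an
  expansion in \<open>Basis\<close>. Tangency of \<open>X\<close> makes its value independent of the
  extension of \<open>Y\<close>.\<close>

lemma smooth_map_differential:
  fixes Y :: "'a::euclidean_space \<Rightarrow> 'b::real_normed_vector"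
  assumes "smooth_map M Y" "smooth_map M X" "\<And>p. p \<in> M \<Longrightarrow> X p \<in> tangent_space M p"
  shows "smooth_map M (\<lambda>p. differential M Y p (X p))"
  unfolding smooth_map_def
proof
  fix p assume p: "p \<in> M"
  obtain U F G where U: "open U" "p \<in> U" "smooth_on U F" "smooth_on U G"
    "\<And>x. x \<in> M \<Longrightarrow> x \<in> U \<Longrightarrow> F x = Y x" "\<And>x. x \<in> M \<Longrightarrow> x \<in> U \<Longrightarrow> G x = X x"
    using smooth_map_common_extension[OF assms(1,2) p] by blast
  let ?H = "\<lambda>x. \<Sum>b\<in>Basis. (G x \<bullet> b) *\<^sub>R frechet_derivative F (at x) b"
  have "smooth_on U ?H"
    unfolding smooth_on_def
    using smooth_on_frechet[OF U(3)] U(4)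
    by (intro allI Ck_on_sum Ck_on_bilinear[OF _ bounded_bilinear_scaleR] U(1)
        Ck_on_bounded_linear[OF _ bounded_linear_inner_left]) (auto simp: smooth_on_def)
  moreover have "?H x = differential M Y x (X x)" if x: "x \<in> M \<inter> U" for x
  proof -
    have F: "(F has_derivative frechet_derivative F (at x)) (at x)"
      using smooth_on_has_derivative[OF U(3)] x by blast
    have "(Y has_derivative frechet_derivative F (at x)) (at x within M)"
      by (rule has_derivative_transform_eventually[OF has_derivative_at_withinI[OF F]])
        (use U x in \<open>auto simp: eventually_at_filter eventually_nhds\<close>)
    then have "differential M Y x (X x) = frechet_derivative F (at x) (X x)"
      using differential_eq assms(3) x by blast
    also have "\<dots> = ?H x"
      using frechet_derivative_sum_Basis[OF F, of "X x"] U(6) x by simp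
    finally show ?thesis by simp
  qed
  ultimately show "\<exists>U F. open U \<and> p \<in> U \<and> smooth_on U F \<and> (\<forall>x\<in>M \<inter> U. F x = differential M Y x (X x))"
    using U by blast
qed

text \<open>The curve representing \<open>v\<close> is pushed forward. Smoothness of the new curve
  comes from a local extension of \<open>f\<close>, hence the restriction to the times
  \<open>W\<close> at which the curve lies in the domain of the extension.\<close>

lemma differential_in_tangent_space:
  fixes f :: "'a::euclidean_space \<Rightarrow> 'b::real_normed_vector"
  assumes "smooth_map M f" "f ` M \<subseteq> N" "p \<in> M" "v \<in> tangent_space M p"
  shows "differential M f p v \<in> tangent_space N (f p)"
proof -
  obtain \<gamma> e where \<gamma>: "e > 0" "smooth_on {-e<..<e} \<gamma>" "\<gamma> ` {-e<..<e} \<subseteq> M" "\<gamma> 0 = p"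
    "(\<gamma> has_vector_derivative v) (at (0::real))"
    using assms(4) unfolding tangent_space_def by blast
  obtain U F where U: "open U" "p \<in> U" "smooth_on U F" "\<And>x. x \<in> M \<inter> U \<Longrightarrow> F x = f x"
    using assms(1,3) unfolding smooth_map_def by metis
  define W where "W = {-e<..<e} \<inter> \<gamma> -` U"
  have W: "open W" "0 \<in> W"
    unfolding W_def
    using continuous_on_open_vimage[of "{-e<..<e}" \<gamma>] smooth_on_continuous[OF \<gamma>(2)] U \<gamma>(1,4)
    by (auto simp: Int_commute)
  have "smooth_on W (\<lambda>x. F (\<gamma> x))"
    by (rule smooth_on_compose[OF U(3) smooth_on_subset[OF \<gamma>(2)] W(1) U(1)]) (auto simp: W_def)
  then have sm: "smooth_on W (\<lambda>x. f (\<gamma> x))"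
    unfolding smooth_on_def
    using Ck_on_cong[OF W(1), of "\<lambda>x. F (\<gamma> x)" "\<lambda>x. f (\<gamma> x)"] U(4) \<gamma>(3)
    by (auto simp: W_def image_subset_iff)
  have F: "(F has_derivative frechet_derivative F (at p)) (at p)"
    using smooth_on_has_derivative[OF U(3)] U(2) by blast
  have "(f has_derivative frechet_derivative F (at p)) (at p within M)"
    by (rule has_derivative_transform_eventually[OF has_derivative_at_withinI[OF F]])
      (use U assms(3) in \<open>auto simp: eventually_at_filter eventually_nhds\<close>)
  then have d: "differential M f p v = frechet_derivative F (at p) v"
    using differential_eq assms(4) by blast
  have "((\<lambda>t. F (\<gamma> t)) has_vector_derivative frechet_derivative F (at p) v) (at 0)"
    using has_derivative_compose[of \<gamma> "\<lambda>h. h *\<^sub>R v" 0 UNIV F "frechet_derivative F (at p)"] \<gamma>(4,5) F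
    unfolding has_vector_derivative_def by (simp add: linear_cmul[OF has_derivative_linear[OF F]])
  then have "((\<lambda>t. f (\<gamma> t)) has_vector_derivative differential M f p v) (at 0)"
    unfolding has_vector_derivative_def d
    by (rule has_derivative_transform_within_open[OF _ W])
      (use U(4) \<gamma>(3) in \<open>auto simp: W_def image_subset_iff\<close>)
  then show ?thesis
    by (rule tangent_spaceI[OF W sm, rotated 2])
      (use assms(2) \<gamma>(3,4) in \<open>auto simp: W_def image_subset_iff\<close>)
qed

section \<open>The Levi-Civita connection\<close>

lemma vector_field_smooth: "vector_field M X \<Longrightarrow> smooth_map M X"
  by (simp add: vector_field_def)

lemma vector_field_tangent: "vector_field M X \<Longrightarrow> p \<in> M \<Longrightarrow> X p \<in> tangent_space M p"
  by (simp add: vector_field_def)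

lemma levi_civita_metric:
  assumes "is_levi_civita M g D" "vector_field M X" "vector_field M Y" "vector_field M Z" "p \<in> M"
  shows "differential M (\<lambda>x. g x (Y x) (Z x)) p (X p) = g p (D X Y p) (Z p) + g p (Y p) (D X Z p)"
  using assms unfolding is_levi_civita_def by blast

text \<open>
  The difference \<open>S\<close> of two Levi-Civita connections is symmetric and \<open>g (S X Y) Z\<close> is skew in
  \<open>Y\<close>, \<open>Z\<close>; a trilinear form with these symmetries vanishes.
\<close>

lemma levi_civita_eq:
  assumes D: "is_levi_civita M g D"
    and sub: "\<And>p. p \<in> M \<Longrightarrow> subspace (tangent_space M p)"
    and sym: "\<And>p x y. p \<in> M \<Longrightarrow> x \<in> tangent_space M p \<Longrightarrow> y \<in> tangent_space M p \<Longrightarrow> g p x y = g p y x"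
    and diff: "\<And>p x y z. p \<in> M \<Longrightarrow> x \<in> tangent_space M p \<Longrightarrow> y \<in> tangent_space M p \<Longrightarrow>
      z \<in> tangent_space M p \<Longrightarrow> g p (x - y) z = g p x z - g p y z"
    and pos: "\<And>p x. p \<in> M \<Longrightarrow> x \<in> tangent_space M p \<Longrightarrow> g p x x = 0 \<Longrightarrow> x = 0"
    and X: "vector_field M X" and Y: "vector_field M Y" and p: "p \<in> M"
  shows "levi_civita M g X Y p = D X Y p"
proof -
  define E where "E = levi_civita M g"
  have E: "is_levi_civita M g E"
    unfolding E_def levi_civita_def using someI[of "is_levi_civita M g", OF D] .
  have vf: "vector_field M (D X Y)" "vector_field M (E X Y)"
    if "vector_field M X" "vector_field M Y" for X Y
    using D E that by (auto simp: is_levi_civita_def is_connection_def)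
  define S where "S X Y q = E X Y q - D X Y q" for X Y q
  have vS: "vector_field M (S X Y)" if "vector_field M X" "vector_field M Y" for X Y
    using vf[OF that] sub unfolding vector_field_def S_def
    by (auto intro: smooth_map_diff subspace_diff)
  have Ssym: "S X Y q = S Y X q" if "vector_field M X" "vector_field M Y" "q \<in> M" for X Y q
  proof -
    have "E X Y q - E Y X q = D X Y q - D Y X q"
      using D E that by (auto simp: is_levi_civita_def)
    then show ?thesis
      by (simp add: S_def algebra_simps)
  qed
  have T: "g q (S X Y q) (Z q) = - g q (S X Z q) (Y q)"
    if "vector_field M X" "vector_field M Y" "vector_field M Z" "q \<in> M" for X Y Z q
  proof -
    have "g q (E X Y q) (Z q) + g q (Y q) (E X Z q) = g q (D X Y q) (Z q) + g q (Y q) (D X Z q)"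
      using levi_civita_metric[OF D that] levi_civita_metric[OF E that] by simp
    then show ?thesis
      unfolding S_def
      using that vf by (simp add: diff sym[of q "Y q"] vector_field_tangent)
  qed
  \<comment> \<open>Alternating symmetry and skewness three times leads from the expression back to
    itself with a minus sign.\<close>
  have "g q (S X Y q) (Z q) = 0"
    if "vector_field M X" "vector_field M Y" "vector_field M Z" "q \<in> M" for X Y Z q
    using T[of X Y Z q] T[of Z X Y q] T[of Y Z X q] Ssym[of X Y q] Ssym[of Y Z q] Ssym[of Z X q] that
    by simp
  \<comment> \<open>\<open>S X Y\<close> is itself a field, so it may stand for \<open>Z\<close>;
    definiteness then applies.\<close>
  from this[OF X Y vS[OF X Y] p] have "S X Y p = 0"
    using pos[OF p] vS[OF X Y] p vector_field_tangent by blast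
  then show ?thesis
    by (simp add: S_def E_def)
qed

text \<open>Linearity and the Leibniz rule come from the ambient derivative, and a symmetric
  \<open>\<Gamma>\<close> cancels in the torsion. What depends on the metric is tangency of the
  result and compatibility.\<close>

lemma is_levi_civita_christoffel:
  fixes \<Gamma> :: "'a::euclidean_space \<Rightarrow> 'a \<Rightarrow> 'a \<Rightarrow> 'a"
  assumes vf: "\<And>X Y. vector_field M X \<Longrightarrow> vector_field M Y \<Longrightarrow>
      vector_field M (\<lambda>p. differential M Y p (X p) + \<Gamma> p (X p) (Y p))"
    and bil: "\<And>p. bilinear (\<Gamma> p)"
    and sym: "\<And>p x y. p \<in> M \<Longrightarrow> \<Gamma> p x y = \<Gamma> p y x"
    and compat: "\<And>p x Y Z. p \<in> M \<Longrightarrow> x \<in> tangent_space M p \<Longrightarrow> vector_field M Y \<Longrightarrow> vector_field M Z \<Longrightarrow>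
      differential M (\<lambda>q. g q (Y q) (Z q)) p x =
        g p (differential M Y p x + \<Gamma> p x (Y p)) (Z p) + g p (Y p) (differential M Z p x + \<Gamma> p x (Z p))"
  shows "is_levi_civita M g (\<lambda>X Y p. differential M Y p (X p) + \<Gamma> p (X p) (Y p))"
proof -
  have lin: "linear (differential M Y p)" if "vector_field M Y" "p \<in> M" for Y p
    using smooth_map_has_derivative[OF vector_field_smooth] that has_derivative_linear by blast
  have add: "differential M (\<lambda>x. Y x + Y' x) p v = differential M Y p v + differential M Y' p v"
    if "vector_field M Y" "vector_field M Y'" "p \<in> M" "v \<in> tangent_space M p" for Y Y' p v
    using that by (intro differential_eq has_derivative_add smooth_map_has_derivative vector_field_smooth)
  have mult: "differential M (\<lambda>x. f x *\<^sub>R Y x) p v = f p *\<^sub>R differential M Y p v + differential M f p v *\<^sub>R Y p"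
    if "smooth_map M f" "vector_field M Y" "p \<in> M" "v \<in> tangent_space M p" for f :: "'a \<Rightarrow> real" and Y p v
    using that by (intro differential_eq has_derivative_scaleR smooth_map_has_derivative vector_field_smooth)
  show ?thesis
    unfolding is_levi_civita_def is_connection_def lie_bracket_def
    using vf bil compat sym
    by (auto simp: vector_field_tangent add mult linear_add[OF lin] linear_cmul[OF lin]
        bilinear_ladd[OF bil] bilinear_radd[OF bil] bilinear_lmul[OF bil] bilinear_rmul[OF bil]
        scaleR_add_right)
qed

section \<open>The unit sphere and its unit tangent bundle\<close>

text \<open>Away from 0, \<open>sgn y\<close> is \<open>y\<close> times the power -1/2 of the smooth
  positive function \<open>y \<bullet> y\<close>. This radial projection produces the curves on the
  sphere and on its unit tangent bundle.\<close>

lemma smooth_on_sgn: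
  fixes f :: "'a::real_normed_vector \<Rightarrow> 'b::euclidean_space"
  assumes "open U" "smooth_on U f" "\<And>x. x \<in> U \<Longrightarrow> f x \<noteq> 0"
  shows "smooth_on U (\<lambda>x. sgn (f x))"
proof -
  have "smooth_on U (\<lambda>x. (f x \<bullet> f x) powr (-(1/2)))"
    by (rule smooth_on_compose[OF smooth_on_powr smooth_on_bilinear[OF assms(1) bounded_bilinear_inner assms(2,2)]])
      (use assms in auto)
  then have "smooth_on U (\<lambda>x. ((f x \<bullet> f x) powr (-(1/2))) *\<^sub>R f x)"
    by (rule smooth_on_bilinear[OF assms(1) bounded_bilinear_scaleR _ assms(2)])
  moreover have "((y \<bullet> y) powr (-(1/2))) *\<^sub>R y = sgn y" for y :: 'b
    by (simp add: powr_minus powr_half_sqrt norm_eq_sqrt_inner sgn_div_norm)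
  ultimately show ?thesis by simp
qed

text \<open>At a unit vector the derivative of radial projection is the orthogonal projection off
  that vector, so velocities orthogonal to it survive normalisation.\<close>

lemma has_derivative_sgn_unit:
  fixes p :: "'a::real_inner"
  assumes "norm p = 1"
  shows "(sgn has_derivative (\<lambda>h. h - (h \<bullet> p) *\<^sub>R p)) (at p)"
proof -
  have "((\<lambda>x. inverse (norm x) *\<^sub>R x) has_derivative (\<lambda>h. h - (h \<bullet> p) *\<^sub>R p)) (at p)"
    using assms
    by (auto intro!: derivative_eq_intros has_derivative_norm simp: sgn_div_norm inner_commute)
  then show ?thesis
    by (simp add: sgn_div_norm[abs_def])
qed

lemma has_vector_derivative_sgn_unit:
  fixes f :: "real \<Rightarrow> 'a::real_inner"
  assumes "(f has_vector_derivative f') (at t)" "norm (f t) = 1" "f' \<bullet> f t = 0"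
  shows "((\<lambda>t. sgn (f t)) has_vector_derivative f') (at t)"
  using has_derivative_compose[OF assms(1)[unfolded has_vector_derivative_def] has_derivative_sgn_unit[OF assms(2)]]
    assms(3) by (simp add: has_vector_derivative_def)

lemma smooth_on_line: "smooth_on UNIV (\<lambda>t::real. p + t *\<^sub>R v)"
  by (intro smooth_on_add smooth_on_const smooth_on_bilinear[OF _ bounded_bilinear_scaleR] smooth_on_id open_UNIV)

lemma line_orthogonal_nonzero:
  assumes "p \<bullet> v = 0" "p \<noteq> 0"
  shows "p + t *\<^sub>R v \<noteq> 0"
proof
  assume "p + t *\<^sub>R v = 0"
  then have "p \<bullet> (p + t *\<^sub>R v) = 0" by simp
  with assms show False by (simp add: inner_add_right)
qed

text \<open>One inclusion differentiates \<open>x \<bullet> x = 1\<close>; for the other, the line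
  through \<open>p\<close> in direction \<open>v\<close> never meets 0 and is normalised.\<close>

lemma tangent_space_sphere:
  fixes p :: "'a::euclidean_space"
  assumes "norm p = 1"
  shows "tangent_space unit_sphere p = {v. v \<bullet> p = 0}"
proof (intro set_eqI iffI; simp)
  fix v assume v: "v \<in> tangent_space unit_sphere p"
  have "((\<lambda>x. x \<bullet> x) has_derivative (\<lambda>h. p \<bullet> h + h \<bullet> p)) (at p within unit_sphere)"
    by (auto intro!: derivative_eq_intros)
  from has_derivative_tangent_eq_0[OF v this, of 1] assms show "v \<bullet> p = 0"
    by (simp add: dot_square_norm inner_commute)
next
  fix v assume v: "v \<bullet> p = 0"
  have nz: "p + t *\<^sub>R v \<noteq> 0" for t
    using line_orthogonal_nonzero[of p v t] v assms by (fastforce simp: inner_commute)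
  have "smooth_on UNIV (\<lambda>t. sgn (p + t *\<^sub>R v))"
    by (rule smooth_on_sgn[OF open_UNIV smooth_on_line nz])
  moreover have "((\<lambda>t. sgn (p + t *\<^sub>R v)) has_vector_derivative v) (at 0)"
    by (rule has_vector_derivative_sgn_unit)
      (use assms v in \<open>auto intro!: derivative_eq_intros simp: has_vector_derivative_def\<close>)
  ultimately show "v \<in> tangent_space unit_sphere p"
    by (intro tangent_spaceI[OF open_UNIV]) (use assms nz in \<open>auto simp: norm_sgn sgn_div_norm\<close>)
qed

lemma subspace_tangent_sphere:
  fixes p :: "'a::euclidean_space"
  assumes "p \<in> unit_sphere"
  shows "subspace (tangent_space unit_sphere p)"
  using assms by (simp add: tangent_space_sphere subspace_def inner_add_left)

lemma unit_tangent_sphere_iff: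
  fixes q v :: "'a::euclidean_space"
  shows "(q, v) \<in> unit_tangent_bundle unit_sphere round_metric \<longleftrightarrow> norm q = 1 \<and> norm v = 1 \<and> v \<bullet> q = 0"
  by (auto simp: unit_tangent_bundle_def tangent_bundle_def tangent_space_sphere round_metric_def
      norm_eq_1)

lemma tangent_space_unit_tangent_sphere:
  fixes q v :: "'a::euclidean_space"
  assumes Q: "(q, v) \<in> unit_tangent_bundle unit_sphere round_metric" (is "_ \<in> ?T")
  shows "tangent_space ?T (q, v) = {(a, b). a \<bullet> q = 0 \<and> b \<bullet> v = 0 \<and> a \<bullet> v + b \<bullet> q = 0}"
proof (intro set_eqI iffI; clarsimp)
  fix a b assume ab: "(a, b) \<in> tangent_space ?T (q, v)"
  have 1: "((\<lambda>x. fst x \<bullet> fst x) has_derivative (\<lambda>h. q \<bullet> fst h + fst h \<bullet> q)) (at (q, v) within ?T)"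
    and 2: "((\<lambda>x. snd x \<bullet> snd x) has_derivative (\<lambda>h. v \<bullet> snd h + snd h \<bullet> v)) (at (q, v) within ?T)"
    and 3: "((\<lambda>x. fst x \<bullet> snd x) has_derivative (\<lambda>h. q \<bullet> snd h + fst h \<bullet> v)) (at (q, v) within ?T)"
    by (auto intro!: derivative_eq_intros)
  have "a \<bullet> q = 0"
    using has_derivative_tangent_eq_0[OF ab 1, of 1] Q
    by (auto simp: unit_tangent_sphere_iff dot_square_norm inner_commute split_paired_all)
  moreover have "b \<bullet> v = 0"
    using has_derivative_tangent_eq_0[OF ab 2, of 1] Q
    by (auto simp: unit_tangent_sphere_iff dot_square_norm inner_commute split_paired_all)
  moreover have "a \<bullet> v + b \<bullet> q = 0"
    using has_derivative_tangent_eq_0[OF ab 3, of 0] Q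
    by (auto simp: unit_tangent_sphere_iff inner_commute split_paired_all)
  ultimately show "a \<bullet> q = 0 \<and> b \<bullet> v = 0 \<and> a \<bullet> v + b \<bullet> q = 0" by blast
next
  fix a b assume a: "a \<bullet> q = 0" and b: "b \<bullet> v = 0" and ab: "a \<bullet> v + b \<bullet> q = 0"
  have Q': "norm q = 1" "norm v = 1" "v \<bullet> q = 0"
    using Q by (auto simp: unit_tangent_sphere_iff)
  define c where "c t = sgn (q + t *\<^sub>R a)" for t :: real
  have nz: "q + t *\<^sub>R a \<noteq> 0" for t
    using line_orthogonal_nonzero[of q a t] a Q' by (fastforce simp: inner_commute)
  have nc: "norm (c t) = 1" for t
    using nz by (simp add: c_def norm_sgn)
  have c0: "c 0 = q"
    using Q' by (simp add: c_def sgn_div_norm)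
  have sc: "smooth_on UNIV c"
    unfolding c_def by (rule smooth_on_sgn[OF open_UNIV smooth_on_line nz])
  have dc: "(c has_vector_derivative a) (at 0)"
    unfolding c_def by (rule has_vector_derivative_sgn_unit)
      (use Q' a in \<open>auto intro!: derivative_eq_intros simp: has_vector_derivative_def\<close>)
  \<comment> \<open>Gram-Schmidt: \<open>v + t *\<^sub>R b\<close> without its component along
    \<open>c t\<close>. The velocity at 0 is \<open>b\<close> minus
    \<open>(a \<bullet> v + b \<bullet> q) *\<^sub>R q\<close>, which is \<open>b\<close> by the
    third tangency equation.\<close>
  define w where "w t = (v + t *\<^sub>R b) + ((v + t *\<^sub>R b) \<bullet> c t) *\<^sub>R (-1) *\<^sub>R c t" for t :: real
  have w0: "w 0 = v"
    using Q' by (simp add: w_def c0)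
  have wc: "w t \<bullet> c t = 0" for t
    using nc[of t] by (simp add: w_def inner_diff_left dot_square_norm)
  have sw: "smooth_on UNIV w"
    unfolding w_def
    by (intro smooth_on_add smooth_on_line smooth_on_bilinear[OF _ bounded_bilinear_scaleR]
        smooth_on_bilinear[OF _ bounded_bilinear_inner] smooth_on_const sc open_UNIV)
  have dw: "(w has_vector_derivative b) (at 0)"
    unfolding w_def has_vector_derivative_def
    by (rule derivative_eq_intros dc[unfolded has_vector_derivative_def] refl)+
      (use Q' a b ab c0 in \<open>auto simp: fun_eq_iff inner_commute algebra_simps simp flip: scaleR_add_left distrib_left\<close>)
  \<comment> \<open>Away from time 0 the vector \<open>w t\<close> may vanish, so it is normalised
    on this neighbourhood only.\<close>
  define U where "U = {t. w t \<noteq> 0}"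
  have "open (w -` (-{0}) \<inter> UNIV)"
    using continuous_on_open_vimage[OF open_UNIV] smooth_on_continuous[OF sw] by blast
  moreover have "w -` (-{0}) \<inter> UNIV = U"
    by (auto simp: U_def)
  ultimately have U: "open U" "0 \<in> U"
    using w0 Q'(2) unfolding U_def by (metis, force)
  show "(a, b) \<in> tangent_space ?T (q, v)"
  proof (rule tangent_spaceI[OF U])
    show "smooth_on U (\<lambda>t. (c t, sgn (w t)))"
      by (intro smooth_on_Pair smooth_on_sgn U(1) smooth_on_subset[OF sc] smooth_on_subset[OF sw])
        (auto simp: U_def)
    show "(\<lambda>t. (c t, sgn (w t))) ` U \<subseteq> ?T"
      using nc wc by (auto simp: unit_tangent_sphere_iff norm_sgn U_def sgn_div_norm)
    show "(c 0, sgn (w 0)) = (q, v)"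
      using c0 w0 Q' by (simp add: sgn_div_norm)
    show "((\<lambda>t. (c t, sgn (w t))) has_vector_derivative (a, b)) (at 0)"
      using has_vector_derivative_Pair[OF dc has_vector_derivative_sgn_unit[OF dw]] w0 Q' b by simp
  qed
qed

lemma subspace_tangent_unit_tangent_sphere:
  fixes Q :: "'a::euclidean_space \<times> 'a"
  assumes "Q \<in> unit_tangent_bundle unit_sphere round_metric"
  shows "subspace (tangent_space (unit_tangent_bundle unit_sphere round_metric) Q)"
proof (cases Q)
  case (Pair q v)
  with assms show ?thesis
    by (auto simp: tangent_space_unit_tangent_sphere subspace_def inner_add_left zero_prod_def algebra_simps
        simp flip: distrib_left)
qed

lemma vector_field_sphere_orthogonal:
  fixes X :: "'a::euclidean_space \<Rightarrow> 'a"
  assumes "vector_field unit_sphere X" "p \<in> unit_sphere"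
  shows "X p \<bullet> p = 0"
  using vector_field_tangent[OF assms] assms(2) by (simp add: tangent_space_sphere)

lemma vector_field_sphere_deriv:
  fixes Y :: "'a::euclidean_space \<Rightarrow> 'a"
  assumes "vector_field unit_sphere Y" "p \<in> unit_sphere" "x \<in> tangent_space unit_sphere p"
  shows "differential unit_sphere Y p x \<bullet> p + Y p \<bullet> x = 0"
proof -
  have "((\<lambda>q. Y q \<bullet> q) has_derivative (\<lambda>h. Y p \<bullet> h + differential unit_sphere Y p h \<bullet> p))
      (at p within unit_sphere)"
    by (rule derivative_eq_intros smooth_map_has_derivative[OF vector_field_smooth] assms refl)+
  from has_derivative_tangent_eq_0[OF assms(3) this, of 0] show ?thesis
    using vector_field_sphere_orthogonal[OF assms(1)] assms(2) by simp
qed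

text \<open>The Gauss formula: the added multiple of \<open>p\<close> cancels the normal component
  of the ambient derivative, found by differentiating \<open>Y q \<bullet> q = 0\<close>. It does
  not disturb compatibility because fields are orthogonal to \<open>p\<close>.\<close>

lemma levi_civita_sphere:
  fixes X Y :: "'a::euclidean_space \<Rightarrow> 'a"
  assumes X: "vector_field unit_sphere X" and Y: "vector_field unit_sphere Y" and p: "p \<in> unit_sphere"
  shows "levi_civita unit_sphere round_metric X Y p
    = differential unit_sphere Y p (X p) + (X p \<bullet> Y p) *\<^sub>R p"
proof -
  have "is_levi_civita unit_sphere round_metric
     (\<lambda>X Y p. differential unit_sphere Y p (X p) + (\<lambda>p x y. (x \<bullet> y) *\<^sub>R (p::'a)) p (X p) (Y p))"
  proof (rule is_levi_civita_christoffel)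
    fix X Y :: "'a \<Rightarrow> 'a" assume XY: "vector_field unit_sphere X" "vector_field unit_sphere Y"
    show "vector_field unit_sphere (\<lambda>p. differential unit_sphere Y p (X p) + (X p \<bullet> Y p) *\<^sub>R p)"
      unfolding vector_field_def
    proof (intro conjI ballI)
      show "smooth_map unit_sphere (\<lambda>p. differential unit_sphere Y p (X p) + (X p \<bullet> Y p) *\<^sub>R p)"
        using XY by (intro smooth_map_intros smooth_map_differential vector_field_smooth vector_field_tangent)
      fix p :: 'a assume "p \<in> unit_sphere"
      then show "differential unit_sphere Y p (X p) + (X p \<bullet> Y p) *\<^sub>R p \<in> tangent_space unit_sphere p"
        using vector_field_sphere_deriv[OF XY(2) _ vector_field_tangent[OF XY(1)], of p]
        by (simp add: tangent_space_sphere inner_add_left dot_square_norm inner_commute[of "Y p"])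
    qed
  next
    show "bilinear (\<lambda>x y. (x \<bullet> y) *\<^sub>R p)" for p :: 'a
      by (auto simp: bilinear_def linear_iff inner_add_left inner_add_right scaleR_add_left)
  next
    show "(x \<bullet> y) *\<^sub>R p = (y \<bullet> x) *\<^sub>R p" for p x y :: 'a
      by (simp add: inner_commute)
  next
    fix p x :: 'a and Y Z :: "'a \<Rightarrow> 'a"
    assume p: "p \<in> unit_sphere" and x: "x \<in> tangent_space unit_sphere p"
      and Y: "vector_field unit_sphere Y" and Z: "vector_field unit_sphere Z"
    have "((\<lambda>q. round_metric q (Y q) (Z q)) has_derivative
        (\<lambda>h. Y p \<bullet> differential unit_sphere Z p h + differential unit_sphere Y p h \<bullet> Z p))
        (at p within unit_sphere)"
      unfolding round_metric_def
      by (rule derivative_eq_intros smooth_map_has_derivative[OF vector_field_smooth] Y Z p refl)+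
    from differential_eq[OF x this]
    show "differential unit_sphere (\<lambda>q. round_metric q (Y q) (Z q)) p x =
       round_metric p (differential unit_sphere Y p x + (x \<bullet> Y p) *\<^sub>R p) (Z p) +
       round_metric p (Y p) (differential unit_sphere Z p x + (x \<bullet> Z p) *\<^sub>R p)"
      using vector_field_sphere_orthogonal[OF Y p] vector_field_sphere_orthogonal[OF Z p]
      by (simp add: round_metric_def inner_add_left inner_add_right inner_commute[of p])
  qed
  then show ?thesis
    by (rule levi_civita_eq[where D = "\<lambda>X Y p. differential unit_sphere Y p (X p) + (X p \<bullet> Y p) *\<^sub>R p"])
      (use X Y p subspace_tangent_sphere in \<open>auto simp: round_metric_def inner_diff_left intro: inner_commute\<close>)
qed

section \<open>The Sasaki metric on the unit tangent bundle\<close>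

abbreviation unit_tangent_sphere :: "('a::euclidean_space \<times> 'a) set" where
  "unit_tangent_sphere \<equiv> unit_tangent_bundle unit_sphere round_metric"

text \<open>The projected constant field extends a vector tangent at a point to the whole sphere,
  and its covariant derivative vanishes at that point. It serves for horizontal lifts and for
  \<open>hess\<close>.\<close>

lemma vector_field_sphere_projection:
  fixes v :: "'a::euclidean_space"
  shows "vector_field unit_sphere (\<lambda>x. v - (v \<bullet> x) *\<^sub>R x)"
  by (auto simp: vector_field_def tangent_space_sphere inner_diff_left dot_square_norm
      intro!: smooth_map_intros)

text \<open>The projected constant fields give existence. For uniqueness, the Gauss formula with
  vanishing covariant derivative determines the ambient derivative of any admissible
  section.\<close>

lemma hlift_sphere:
  fixes q v a :: "'a::euclidean_space"
  assumes q: "norm q = 1" and v: "v \<bullet> q = 0" and a: "a \<bullet> q = 0"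
  shows "hlift unit_sphere round_metric (q, v) a = (a, - (a \<bullet> v) *\<^sub>R q)"
  unfolding hlift_def fst_conv snd_conv
proof (rule the_equality)
  have p: "q \<in> unit_sphere" using q by simp
  let ?V = "\<lambda>x. v - (v \<bullet> x) *\<^sub>R x" and ?W = "\<lambda>x. a - (a \<bullet> x) *\<^sub>R x"
  have "(?V has_derivative (\<lambda>h. - ((v \<bullet> q) *\<^sub>R h + (v \<bullet> h) *\<^sub>R q))) (at q within unit_sphere)"
    by (auto intro!: derivative_eq_intros)
  moreover have "a \<in> tangent_space unit_sphere q"
    using a q by (simp add: tangent_space_sphere)
  ultimately have d: "differential unit_sphere ?V q a = - (a \<bullet> v) *\<^sub>R q"
    using differential_eq v by (fastforce simp: inner_commute)
  have "levi_civita unit_sphere round_metric ?W ?V q = 0"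
    by (subst levi_civita_sphere[OF vector_field_sphere_projection vector_field_sphere_projection p])
      (simp add: a v d)
  then show "\<exists>V W. vector_field unit_sphere V \<and> vector_field unit_sphere W \<and> V q = v \<and> W q = a \<and>
      levi_civita unit_sphere round_metric W V q = 0 \<and>
      (a, - (a \<bullet> v) *\<^sub>R q) = (a, differential unit_sphere V q a)"
    using vector_field_sphere_projection a v d by (intro exI[of _ ?V] exI[of _ ?W]) auto
  fix H
  assume "\<exists>V W. vector_field unit_sphere V \<and> vector_field unit_sphere W \<and> V q = v \<and> W q = a \<and>
      levi_civita unit_sphere round_metric W V q = 0 \<and> H = (a, differential unit_sphere V q a)"
  then show "H = (a, - (a \<bullet> v) *\<^sub>R q)"
    using levi_civita_sphere[OF _ _ p] by (auto simp: add_eq_0_iff2)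
qed

lemma vcomp_sphere:
  fixes q v a b :: "'a::euclidean_space"
  assumes "(q, v) \<in> unit_tangent_sphere" "a \<bullet> q = 0"
  shows "vcomp unit_sphere round_metric (q, v) (a, b) = b + (a \<bullet> v) *\<^sub>R q"
  using assms by (simp add: vcomp_def hcomp_def unit_tangent_sphere_iff hlift_sphere)

text \<open>For a tangent vector \<open>(a, b)\<close> at \<open>(q, v)\<close> one has
  \<open>a \<bullet> v = - (b \<bullet> q)\<close>, so \<open>vcomp\<close> projects
  \<open>b\<close> orthogonally off \<open>q\<close>. The subtracted product is the part lost in
  this projection.\<close>

lemma sasaki_metric_sphere:
  fixes Q A B :: "'a::euclidean_space \<times> 'a"
  assumes Q: "Q \<in> unit_tangent_sphere"
    and A: "A \<in> tangent_space unit_tangent_sphere Q"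
    and B: "B \<in> tangent_space unit_tangent_sphere Q"
  shows "sasaki_metric unit_sphere round_metric Q A B
    = fst A \<bullet> fst B + snd A \<bullet> snd B - (snd A \<bullet> fst Q) * (snd B \<bullet> fst Q)"
proof -
  obtain q v a b c d where eq: "Q = (q, v)" "A = (a, b)" "B = (c, d)"
    by (metis surj_pair)
  have t: "a \<bullet> q = 0" "c \<bullet> q = 0" "a \<bullet> v = - (b \<bullet> q)" "c \<bullet> v = - (d \<bullet> q)" "q \<bullet> q = 1"
    using Q A B unfolding eq
    by (auto simp: tangent_space_unit_tangent_sphere unit_tangent_sphere_iff dot_square_norm)
  have "sasaki_metric unit_sphere round_metric Q A B = a \<bullet> c + (b - (b \<bullet> q) *\<^sub>R q) \<bullet> (d - (d \<bullet> q) *\<^sub>R q)"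
    using t Q by (simp add: eq sasaki_metric_def hcomp_def vcomp_sphere round_metric_def)
  also have "\<dots> = a \<bullet> c + b \<bullet> d - (b \<bullet> q) * (d \<bullet> q)"
    using t(5) by (simp add: inner_diff_left inner_diff_right inner_commute[of q d])
  finally show ?thesis
    by (simp add: eq)
qed

text \<open>
  Up to multiples of \<open>fst Q\<close> and \<open>snd Q\<close>, which make the result tangent to the bundle, this is
  Kowalski's description of the Sasaki connection,
  \<open>\<nabla>(X\<^sup>h) Y\<^sup>h = (\<nabla>\<^sub>X Y)\<^sup>h - (R(X,Y)\<xi>)\<^sup>v / 2\<close>, \<open>\<nabla>(X\<^sup>h) Y\<^sup>v = (\<nabla>\<^sub>X Y)\<^sup>v + (R(\<xi>,Y)X)\<^sup>h / 2\<close>,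
  \<open>\<nabla>(X\<^sup>v) Y\<^sup>h = (R(\<xi>,X)Y)\<^sup>h / 2\<close>, in ambient coordinates, with \<open>R(X,Y)Z = (Y \<bullet> Z) X - (X \<bullet> Z) Y\<close>.
\<close>

definition sasaki_christoffel ::
    "'a::euclidean_space \<times> 'a \<Rightarrow> 'a \<times> 'a \<Rightarrow> 'a \<times> 'a \<Rightarrow> 'a \<times> 'a" where
  "sasaki_christoffel Q X Y =
    (let c = (fst X \<bullet> snd Q) * (fst Y \<bullet> snd Q); s = (fst Y \<bullet> snd X + fst X \<bullet> snd Y) / 2 in
     ((fst X \<bullet> fst Y - c) *\<^sub>R fst Q + s *\<^sub>R snd Q
        - (1/2) *\<^sub>R ((fst X \<bullet> snd Q) *\<^sub>R snd Y + (fst Y \<bullet> snd Q) *\<^sub>R snd X),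
      (snd X \<bullet> snd Y - c) *\<^sub>R snd Q + s *\<^sub>R fst Q
        + (1/2) *\<^sub>R ((fst X \<bullet> snd Q) *\<^sub>R fst Y + (fst Y \<bullet> snd Q) *\<^sub>R fst X)))"

lemma sasaki_christoffel_simp:
  "sasaki_christoffel (q, v) (x1, x2) (y1, y2) =
    ((x1 \<bullet> y1 - (x1 \<bullet> v) * (y1 \<bullet> v)) *\<^sub>R q + ((y1 \<bullet> x2 + x1 \<bullet> y2) / 2) *\<^sub>R v
        - (1/2) *\<^sub>R ((x1 \<bullet> v) *\<^sub>R y2 + (y1 \<bullet> v) *\<^sub>R x2),
     (x2 \<bullet> y2 - (x1 \<bullet> v) * (y1 \<bullet> v)) *\<^sub>R v + ((y1 \<bullet> x2 + x1 \<bullet> y2) / 2) *\<^sub>R q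
        + (1/2) *\<^sub>R ((x1 \<bullet> v) *\<^sub>R y1 + (y1 \<bullet> v) *\<^sub>R x1))"
  by (simp add: sasaki_christoffel_def Let_def)

lemma sasaki_christoffel_commute: "sasaki_christoffel Q X Y = sasaki_christoffel Q Y X"
  by (cases Q; cases X; cases Y) (simp add: sasaki_christoffel_simp inner_commute algebra_simps)

lemma bilinear_sasaki_christoffel: "bilinear (sasaki_christoffel Q)"
proof -
  have 1: "linear (sasaki_christoffel Q X)" for X
    by (rule linearI; cases Q; cases X)
      (auto simp: sasaki_christoffel_simp inner_simps algebra_simps add_divide_distrib)
  moreover have "linear (\<lambda>X. sasaki_christoffel Q X Y)" for Y
    using 1[of Y] by (simp add: sasaki_christoffel_commute[of Q _ Y])
  ultimately show ?thesis
    by (simp add: bilinear_def)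
qed

text \<open>The hypotheses on \<open>c\<close> are what differentiating the three tangency equations
  yields for the ambient derivative of a tangent field. The multiples of \<open>q\<close> and
  \<open>v\<close> in \<open>sasaki_christoffel\<close> compensate the inner products occurring
  there.\<close>

lemma sasaki_christoffel_tangent:
  assumes Q: "(q, v) \<in> unit_tangent_sphere"
    and x: "x1 \<bullet> q = 0" "x2 \<bullet> v = 0" "x1 \<bullet> v + x2 \<bullet> q = 0"
    and y: "y1 \<bullet> q = 0" "y2 \<bullet> v = 0" "y1 \<bullet> v + y2 \<bullet> q = 0"
    and c: "fst c \<bullet> q + y1 \<bullet> x1 = 0" "snd c \<bullet> v + y2 \<bullet> x2 = 0"
      "fst c \<bullet> v + y1 \<bullet> x2 + (snd c \<bullet> q + y2 \<bullet> x1) = 0"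
  shows "c + sasaki_christoffel (q, v) (x1, x2) (y1, y2)
    \<in> tangent_space unit_tangent_sphere (q, v)"
proof (cases c)
  case (Pair c1 c2)
  have e: "x2 \<bullet> q = - (x1 \<bullet> v)" "y2 \<bullet> q = - (y1 \<bullet> v)" "c1 \<bullet> q = - (x1 \<bullet> y1)" "c2 \<bullet> v = - (x2 \<bullet> y2)"
    "c1 \<bullet> v = - (c2 \<bullet> q) - y1 \<bullet> x2 - x1 \<bullet> y2"
    using x y c by (auto simp: Pair inner_commute)
  have u: "q \<bullet> q = 1" "v \<bullet> v = 1" "v \<bullet> q = 0" "q \<bullet> v = 0"
    using Q by (auto simp: unit_tangent_sphere_iff dot_square_norm inner_commute)
  show ?thesis
    unfolding Pair tangent_space_unit_tangent_sphere[OF Q] sasaki_christoffel_simp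
    using x(1,2) y(1,2) by (simp add: inner_add_left inner_diff_left e u field_simps)
qed

text \<open>These are the Christoffel symbols with lowered index. Pairing with a tangent vector
  removes the multiples of \<open>q\<close> in both components and that of \<open>v\<close> in the
  second; the factor 2 clears the halves.\<close>

lemma sasaki_christoffel_metric:
  assumes Q: "(q, v) \<in> unit_tangent_sphere"
    and x: "x1 \<bullet> q = 0"
    and y: "y1 \<bullet> q = 0"
    and z: "z1 \<bullet> q = 0" "z2 \<bullet> v = 0" "z1 \<bullet> v + z2 \<bullet> q = 0"
    and g: "sasaki_christoffel (q, v) (x1, x2) (y1, y2) = (g1, g2)"
  shows "2 * (g1 \<bullet> z1 + g2 \<bullet> z2 - (g2 \<bullet> q) * (z2 \<bullet> q)) =
    (y1 \<bullet> x2 + x1 \<bullet> y2) * (z1 \<bullet> v) + (x1 \<bullet> v) * (y1 \<bullet> z2 - y2 \<bullet> z1)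
      + (y1 \<bullet> v) * (x1 \<bullet> z2 - x2 \<bullet> z1)"
proof -
  have e: "q \<bullet> z1 = 0" "v \<bullet> z2 = 0" "v \<bullet> z1 = z1 \<bullet> v" "q \<bullet> z2 = z2 \<bullet> q" "z2 \<bullet> q = - (z1 \<bullet> v)"
    using z by (auto simp: inner_commute)
  have u: "q \<bullet> q = 1" "v \<bullet> v = 1" "v \<bullet> q = 0" "q \<bullet> v = 0"
    using Q by (auto simp: unit_tangent_sphere_iff dot_square_norm inner_commute)
  have "g1 = fst (sasaki_christoffel (q, v) (x1, x2) (y1, y2))"
    "g2 = snd (sasaki_christoffel (q, v) (x1, x2) (y1, y2))"
    by (simp_all add: g)
  note g12 = this[unfolded sasaki_christoffel_simp fst_conv snd_conv]
  show ?thesis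
    unfolding g12 using x y
    by (simp add: inner_add_left inner_diff_left e u field_simps)
qed

lemma vector_field_unit_tangent_sphere_deriv:
  fixes Y :: "'a::euclidean_space \<times> 'a \<Rightarrow> 'a \<times> 'a"
  assumes Y: "vector_field unit_tangent_sphere Y"
    and Q: "(q, v) \<in> unit_tangent_sphere" and x: "x \<in> tangent_space unit_tangent_sphere (q, v)"
    and c: "c = differential unit_tangent_sphere Y (q, v) x" and y: "y = Y (q, v)"
  shows "fst c \<bullet> q + fst y \<bullet> fst x = 0" "snd c \<bullet> v + snd y \<bullet> snd x = 0"
    "fst c \<bullet> v + fst y \<bullet> snd x + (snd c \<bullet> q + snd y \<bullet> fst x) = 0"
proof -
  have dY: "(Y has_derivative differential unit_tangent_sphere Y (q, v)) (at (q, v) within unit_tangent_sphere)"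
    by (rule smooth_map_has_derivative[OF vector_field_smooth[OF Y] Q])
  note tan = vector_field_tangent[OF Y]
  have t: "fst (Y P) \<bullet> fst P = 0" "snd (Y P) \<bullet> snd P = 0"
      "fst (Y P) \<bullet> snd P + snd (Y P) \<bullet> fst P = 0" if "P \<in> unit_tangent_sphere" for P
    using tan[OF that] that tangent_space_unit_tangent_sphere[of "fst P" "snd P"]
    by (auto simp: case_prod_unfold)
  have "((\<lambda>P. fst (Y P) \<bullet> fst P) has_derivative
      (\<lambda>h. fst (Y (q, v)) \<bullet> fst h + fst (differential unit_tangent_sphere Y (q, v) h) \<bullet> q)) (at (q, v) within unit_tangent_sphere)"
    by (auto intro!: derivative_eq_intros dY)
  from has_derivative_tangent_eq_0[OF x this t(1) Q] show "fst c \<bullet> q + fst y \<bullet> fst x = 0"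
    by (simp add: c y)
  have "((\<lambda>P. snd (Y P) \<bullet> snd P) has_derivative
      (\<lambda>h. snd (Y (q, v)) \<bullet> snd h + snd (differential unit_tangent_sphere Y (q, v) h) \<bullet> v)) (at (q, v) within unit_tangent_sphere)"
    by (auto intro!: derivative_eq_intros dY)
  from has_derivative_tangent_eq_0[OF x this t(2) Q] show "snd c \<bullet> v + snd y \<bullet> snd x = 0"
    by (simp add: c y)
  have "((\<lambda>P. fst (Y P) \<bullet> snd P + snd (Y P) \<bullet> fst P) has_derivative
      (\<lambda>h. (fst (Y (q, v)) \<bullet> snd h + fst (differential unit_tangent_sphere Y (q, v) h) \<bullet> v) +
        (snd (Y (q, v)) \<bullet> fst h + snd (differential unit_tangent_sphere Y (q, v) h) \<bullet> q))) (at (q, v) within unit_tangent_sphere)"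
    by (auto intro!: derivative_eq_intros dY)
  from has_derivative_tangent_eq_0[OF x this t(3) Q]
  show "fst c \<bullet> v + fst y \<bullet> snd x + (snd c \<bullet> q + snd y \<bullet> fst x) = 0"
    by (simp add: c y)
qed

lemma smooth_map_sasaki_christoffel:
  fixes X Y :: "'a::euclidean_space \<times> 'a \<Rightarrow> 'a \<times> 'a"
  assumes "smooth_map M X" "smooth_map M Y"
  shows "smooth_map M (\<lambda>Q. sasaki_christoffel Q (X Q) (Y Q))"
  unfolding sasaki_christoffel_def Let_def divide_inverse
  using assms by (intro smooth_map_intros)

lemma is_levi_civita_sasaki:
  fixes T
  defines "T \<equiv> (unit_tangent_sphere :: ('a::euclidean_space \<times> 'a) set)"
  shows "is_levi_civita T (sasaki_metric unit_sphere round_metric)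
    (\<lambda>X Y Q. differential T Y Q (X Q) + sasaki_christoffel Q (X Q) (Y Q))"
proof (rule is_levi_civita_christoffel)
  have tan: "fst A \<bullet> fst Q = 0" "snd A \<bullet> snd Q = 0" "fst A \<bullet> snd Q + snd A \<bullet> fst Q = 0"
    if "Q \<in> T" "A \<in> tangent_space T Q" for Q A
    using that tangent_space_unit_tangent_sphere[of "fst Q" "snd Q"]
    by (auto simp: T_def case_prod_unfold)
  have Dtan: "differential T Y Q x + sasaki_christoffel Q x (Y Q) \<in> tangent_space T Q"
    if Y: "vector_field T Y" and Q: "Q \<in> T" and x: "x \<in> tangent_space T Q" for Q Y x
  proof -
    obtain q v x1 x2 y1 y2 where eq: "Q = (q, v)" "x = (x1, x2)" "Y (q, v) = (y1, y2)"
      by (metis surj_pair)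
    show ?thesis
      using tan[OF Q x] tan[OF Q vector_field_tangent[OF Y Q]]
        vector_field_unit_tangent_sphere_deriv[OF Y[unfolded T_def] Q[unfolded T_def eq]
          x[unfolded T_def eq(1)] refl refl] Q
      unfolding eq T_def
      by (auto simp: eq intro!: sasaki_christoffel_tangent)
  qed
  {
    fix X Y assume XY: "vector_field T X" "vector_field T Y"
    show "vector_field T (\<lambda>Q. differential T Y Q (X Q) + sasaki_christoffel Q (X Q) (Y Q))"
      unfolding vector_field_def
    proof (intro conjI ballI Dtan XY)
      show "smooth_map T (\<lambda>Q. differential T Y Q (X Q) + sasaki_christoffel Q (X Q) (Y Q))"
        using XY by (intro smooth_map_add smooth_map_sasaki_christoffel
            smooth_map_differential vector_field_smooth vector_field_tangent)
    qed (simp_all add: XY vector_field_tangent)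
  }
  show "bilinear (sasaki_christoffel Q)" for Q :: "'a \<times> 'a"
    by (rule bilinear_sasaki_christoffel)
  show "sasaki_christoffel Q X Y = sasaki_christoffel Q Y X" for Q X Y :: "'a \<times> 'a"
    by (rule sasaki_christoffel_commute)
  fix Q x and Y Z :: "'a \<times> 'a \<Rightarrow> 'a \<times> 'a"
  assume Q: "Q \<in> T" and x: "x \<in> tangent_space T Q" and Y: "vector_field T Y" and Z: "vector_field T Z"
  let ?g = "\<lambda>Q A B. fst A \<bullet> fst B + snd A \<bullet> snd B - (snd A \<bullet> fst Q) * (snd B \<bullet> fst Q)"
  have g: "sasaki_metric unit_sphere round_metric Q A B = ?g Q A B"
    if "Q \<in> T" "A \<in> tangent_space T Q" "B \<in> tangent_space T Q" for Q A B
    using that sasaki_metric_sphere unfolding T_def by blast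
  let ?DY = "differential T Y Q x" and ?DZ = "differential T Z Q x"
  have d: "((\<lambda>Q. ?g Q (Y Q) (Z Q)) has_derivative
      (\<lambda>h. (fst (Y Q) \<bullet> fst (differential T Z Q h) + fst (differential T Y Q h) \<bullet> fst (Z Q))
        + (snd (Y Q) \<bullet> snd (differential T Z Q h) + snd (differential T Y Q h) \<bullet> snd (Z Q))
        - ((snd (Y Q) \<bullet> fst Q) * (snd (Z Q) \<bullet> fst h + snd (differential T Z Q h) \<bullet> fst Q)
          + (snd (Y Q) \<bullet> fst h + snd (differential T Y Q h) \<bullet> fst Q) * (snd (Z Q) \<bullet> fst Q))))
      (at Q within T)"
    by (rule derivative_eq_intros smooth_map_has_derivative[OF vector_field_smooth] Y Z Q refl)+
  \<comment> \<open>\<open>?g\<close> agrees with the Sasaki metric on tangent vectors only, which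
    suffices since both fields are tangent along \<open>T\<close>.\<close>
  have "((\<lambda>Q. sasaki_metric unit_sphere round_metric Q (Y Q) (Z Q)) has_derivative
      (\<lambda>h. (fst (Y Q) \<bullet> fst (differential T Z Q h) + fst (differential T Y Q h) \<bullet> fst (Z Q))
        + (snd (Y Q) \<bullet> snd (differential T Z Q h) + snd (differential T Y Q h) \<bullet> snd (Z Q))
        - ((snd (Y Q) \<bullet> fst Q) * (snd (Z Q) \<bullet> fst h + snd (differential T Z Q h) \<bullet> fst Q)
          + (snd (Y Q) \<bullet> fst h + snd (differential T Y Q h) \<bullet> fst Q) * (snd (Z Q) \<bullet> fst Q))))
      (at Q within T)"
    by (rule has_derivative_transform[OF Q _ d]) (simp add: g Y Z vector_field_tangent)
  note dg = differential_eq[OF x this]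
  obtain q v x1 x2 y1 y2 z1 z2 c1 c2 e1 e2 where eq: "Q = (q, v)" "x = (x1, x2)" "Y Q = (y1, y2)"
    "Z Q = (z1, z2)" "?DY = (c1, c2)" "?DZ = (e1, e2)"
    by (metis surj_pair)
  obtain g1 g2 h1 h2 where G: "sasaki_christoffel (q, v) (x1, x2) (y1, y2) = (g1, g2)"
    "sasaki_christoffel (q, v) (x1, x2) (z1, z2) = (h1, h2)"
    by (metis surj_pair)
  have t: "x1 \<bullet> q = 0" "x1 \<bullet> v + x2 \<bullet> q = 0" "y1 \<bullet> q = 0" "y2 \<bullet> v = 0" "y1 \<bullet> v + y2 \<bullet> q = 0"
    "z1 \<bullet> q = 0" "z2 \<bullet> v = 0" "z1 \<bullet> v + z2 \<bullet> q = 0"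
    using tan[OF Q x] tan[OF Q vector_field_tangent[OF Y Q]] tan[OF Q vector_field_tangent[OF Z Q]]
    unfolding eq(2-4) by (simp_all add: eq(1))
  have Q': "(q, v) \<in> unit_tangent_sphere"
    using Q by (simp add: eq T_def)
  have GY: "2 * (g1 \<bullet> z1 + g2 \<bullet> z2 - (g2 \<bullet> q) * (z2 \<bullet> q)) =
    (y1 \<bullet> x2 + x1 \<bullet> y2) * (z1 \<bullet> v) + (x1 \<bullet> v) * (y1 \<bullet> z2 - y2 \<bullet> z1)
      + (y1 \<bullet> v) * (x1 \<bullet> z2 - x2 \<bullet> z1)"
    using t by (intro sasaki_christoffel_metric[OF Q' _ _ _ _ _ G(1)]) auto
  have GZ: "2 * (h1 \<bullet> y1 + h2 \<bullet> y2 - (h2 \<bullet> q) * (y2 \<bullet> q)) =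
    (z1 \<bullet> x2 + x1 \<bullet> z2) * (y1 \<bullet> v) + (x1 \<bullet> v) * (z1 \<bullet> y2 - z2 \<bullet> y1)
      + (z1 \<bullet> v) * (x1 \<bullet> y2 - x2 \<bullet> y1)"
    using t by (intro sasaki_christoffel_metric[OF Q' _ _ _ _ _ G(2)]) auto
  \<comment> \<open>In the sum the terms skew in \<open>y\<close> and \<open>z\<close> cancel. The
    rest balances the derivative of the foot point \<open>fst Q\<close> in the subtracted product of
    \<open>?g\<close>.\<close>
  have sm: "2 * ((g1 \<bullet> z1 + g2 \<bullet> z2 - (g2 \<bullet> q) * (z2 \<bullet> q)) + (h1 \<bullet> y1 + h2 \<bullet> y2 - (h2 \<bullet> q) * (y2 \<bullet> q)))
    = 2 * ((x1 \<bullet> y2) * (z1 \<bullet> v) + (x1 \<bullet> z2) * (y1 \<bullet> v))"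
    unfolding distrib_left[of 2 _ "h1 \<bullet> y1 + _ - _"] GY GZ
    by (simp add: inner_commute algebra_simps)
  have zy: "z1 \<bullet> v = - (z2 \<bullet> q)" "y1 \<bullet> v = - (y2 \<bullet> q)"
    using t by auto
  have "differential T (\<lambda>Q. sasaki_metric unit_sphere round_metric Q (Y Q) (Z Q)) Q x =
     ?g Q (?DY + sasaki_christoffel Q x (Y Q)) (Z Q) + ?g Q (Y Q) (?DZ + sasaki_christoffel Q x (Z Q))"
    unfolding dg unfolding eq(3-6) unfolding eq(1,2) G fst_conv snd_conv add_Pair
    using sm unfolding zy
    by (simp add: inner_add_left inner_add_right inner_commute algebra_simps)
  then show "differential T (\<lambda>Q. sasaki_metric unit_sphere round_metric Q (Y Q) (Z Q)) Q x =
     sasaki_metric unit_sphere round_metric Q (?DY + sasaki_christoffel Q x (Y Q)) (Z Q)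
     + sasaki_metric unit_sphere round_metric Q (Y Q) (?DZ + sasaki_christoffel Q x (Z Q))"
    using g[OF Q Dtan[OF Y Q x] vector_field_tangent[OF Z Q]]
      g[OF Q vector_field_tangent[OF Y Q] Dtan[OF Z Q x]] by simp
qed

text \<open>The point to check for uniqueness is definiteness: a null vector \<open>(a, b)\<close>
  has \<open>a = 0\<close> and \<open>b\<close> parallel to \<open>q\<close>, and the equation
  \<open>a \<bullet> v + b \<bullet> q = 0\<close> then gives \<open>b = 0\<close>.\<close>

lemma levi_civita_sasaki:
  fixes X Y :: "'a::euclidean_space \<times> 'a \<Rightarrow> 'a \<times> 'a"
  assumes "vector_field unit_tangent_sphere X"
    and "vector_field unit_tangent_sphere Y" and "Q \<in> unit_tangent_sphere"
  shows "levi_civita unit_tangent_sphere (sasaki_metric unit_sphere round_metric) X Y Q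
    = differential unit_tangent_sphere Y Q (X Q) + sasaki_christoffel Q (X Q) (Y Q)"
proof (rule levi_civita_eq[OF is_levi_civita_sasaki _ _ _ _ assms])
  fix P A B C :: "'a \<times> 'a" assume P: "P \<in> unit_tangent_sphere"
  then show sub: "subspace (tangent_space unit_tangent_sphere P)"
    by (rule subspace_tangent_unit_tangent_sphere)
  assume A: "A \<in> tangent_space unit_tangent_sphere P"
  {
    assume 0: "sasaki_metric unit_sphere round_metric P A A = 0"
    obtain q v a b where eq: "P = (q, v)" "A = (a, b)"
      by (metis surj_pair)
    have "a \<bullet> a + (b \<bullet> b - (b \<bullet> q)\<^sup>2) = 0"
      using sasaki_metric_sphere[OF P A A] 0 by (simp add: eq power2_eq_square)
    moreover have "(b - (b \<bullet> q) *\<^sub>R q) \<bullet> (b - (b \<bullet> q) *\<^sub>R q) = b \<bullet> b - (b \<bullet> q)\<^sup>2"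
      using P by (simp add: eq unit_tangent_sphere_iff inner_diff_left inner_diff_right inner_commute[of q b]
          dot_square_norm[of q] power2_eq_square)
    ultimately have z: "a = 0" "b - (b \<bullet> q) *\<^sub>R q = 0"
      by (metis add_nonneg_eq_0_iff inner_eq_zero_iff inner_ge_zero)+
    have "b \<bullet> q = 0"
      using A P z(1) tangent_space_unit_tangent_sphere[of q v] by (simp add: eq)
    with z show "A = 0"
      by (simp add: eq zero_prod_def)
  }
  assume B: "B \<in> tangent_space unit_tangent_sphere P"
  show "sasaki_metric unit_sphere round_metric P A B = sasaki_metric unit_sphere round_metric P B A"
    using A B by (simp add: sasaki_metric_sphere[OF P] inner_commute)
  assume C: "C \<in> tangent_space unit_tangent_sphere P"
  have "A - B \<in> tangent_space unit_tangent_sphere P"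
    using sub A B by (rule subspace_diff)
  then show "sasaki_metric unit_sphere round_metric P (A - B) C
      = sasaki_metric unit_sphere round_metric P A C - sasaki_metric unit_sphere round_metric P B C"
    using A B C by (simp add: sasaki_metric_sphere[OF P] inner_diff_left algebra_simps)
qed

section \<open>The second derivative of a field on the sphere\<close>

text \<open>
  With a local extension \<open>F\<close> of \<open>f\<close>, take \<open>K x y = F''(p) x y - (x \<bullet> y) F'(p) p\<close>.
\<close>

lemma sphere_second_derivative:
  fixes f :: "'a::euclidean_space \<Rightarrow> 'b::euclidean_space"
  assumes f: "smooth_map unit_sphere f" and p: "p \<in> unit_sphere"
  obtains K where "bilinear K" "\<And>x y. K x y = K y x"
    "\<And>Y x. vector_field unit_sphere Y \<Longrightarrow> x \<in> tangent_space unit_sphere p \<Longrightarrow>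
      differential unit_sphere (\<lambda>q. differential unit_sphere f q (Y q)) p x =
        K x (Y p) + differential unit_sphere f p (differential unit_sphere Y p x + (x \<bullet> Y p) *\<^sub>R p)"
proof -
  let ?S = "unit_sphere :: 'a set"
  obtain U F where U: "open U" "p \<in> U" "smooth_on U F" "\<And>x. x \<in> ?S \<inter> U \<Longrightarrow> F x = f x"
    using f p unfolding smooth_map_def by metis
  define F' where "F' q = frechet_derivative F (at q)" for q
  define F'' where "F'' y = frechet_derivative (\<lambda>q. F' q y) (at p)" for y
  have F': "(F has_derivative F' q) (at q)" if "q \<in> U" for q
    using smooth_on_has_derivative[OF U(3) that] by (simp add: F'_def)
  have F'': "((\<lambda>q. F' q y) has_derivative F'' y) (at p)" for y
    using smooth_on_has_derivative[OF smooth_on_frechet[OF U(3)] U(2)] by (simp add: F'_def F''_def)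
  have sym: "F'' y x = F'' x y" for x y
    using smooth_on_mixed_derivatives[OF U(1,2,3)] by (simp add: F'_def F''_def)
  have lin: "linear (F'' y)" for y
    using F'' has_derivative_linear by blast
  have dF: "differential ?S f q v = F' q v" if "q \<in> ?S" "q \<in> U" "v \<in> tangent_space ?S q" for q v
  proof -
    have "(f has_derivative F' q) (at q within ?S)"
      by (rule has_derivative_transform_eventually[OF has_derivative_at_withinI[OF F'[OF that(2)]]])
        (use U that in \<open>auto simp: eventually_at_filter eventually_nhds\<close>)
    then show ?thesis
      using differential_eq that(3) by blast
  qed
  \<comment> \<open>The ambient derivative of a tangent field \<open>Y\<close> has normal part
    \<open>- (x \<bullet> Y p) *\<^sub>R p\<close>, on which \<open>F'\<close> is not determined by
    \<open>f\<close>. Its contribution is symmetric in \<open>x\<close> and \<open>Y p\<close>, so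
    \<open>K\<close> can absorb it.\<close>
  define K where "K x y = F'' y x - (x \<bullet> y) *\<^sub>R F' p p" for x y
  have "linear (\<lambda>x. K x y)" for y
    unfolding K_def
    by (rule linearI) (auto simp: linear_add[OF lin] linear_cmul[OF lin] inner_add_left algebra_simps)
  moreover have Ksym: "K x y = K y x" for x y
    by (simp add: K_def sym[of x y] inner_commute)
  ultimately have "bilinear K"
    unfolding bilinear_def by (metis (no_types, lifting) ext)
  moreover note Ksym
  moreover have "differential ?S (\<lambda>q. differential ?S f q (Y q)) p x =
      K x (Y p) + differential ?S f p (differential ?S Y p x + (x \<bullet> Y p) *\<^sub>R p)"
    if Y: "vector_field ?S Y" and x: "x \<in> tangent_space ?S p" for Y x
  proof -
    note dY = smooth_map_has_derivative[OF vector_field_smooth[OF Y] p]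
    have linF: "linear (F' p)"
      using F'[OF U(2)] has_derivative_linear by blast
    \<comment> \<open>The direction \<open>Y q\<close> varies, while \<open>F''\<close>
      differentiates \<open>F'\<close> in fixed directions; hence the expansion.\<close>
    have "((\<lambda>q. \<Sum>b\<in>Basis. (Y q \<bullet> b) *\<^sub>R F' q b) has_derivative
        (\<lambda>h. \<Sum>b\<in>Basis. (Y p \<bullet> b) *\<^sub>R F'' b h + (differential ?S Y p h \<bullet> b) *\<^sub>R F' p b)) (at p within ?S)"
      by (intro has_derivative_sum has_derivative_scaleR has_derivative_inner_left dY
          has_derivative_at_withinI[OF F''])
    moreover have "(\<Sum>b\<in>Basis. (Y p \<bullet> b) *\<^sub>R F'' b h + (differential ?S Y p h \<bullet> b) *\<^sub>R F' p b)
        = F'' (Y p) h + F' p (differential ?S Y p h)" for h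
    proof -
      have "(\<Sum>b\<in>Basis. (Y p \<bullet> b) *\<^sub>R F'' b h) = (\<Sum>b\<in>Basis. (Y p \<bullet> b) *\<^sub>R F'' h b)"
        by (intro sum.cong refl arg_cong2[where f = scaleR] sym)
      then show ?thesis
        using frechet_derivative_sum_Basis[OF F'', of h "Y p"] sym[of "Y p" h]
          frechet_derivative_sum_Basis[OF F'[OF U(2)], of "differential ?S Y p h"]
        by (simp add: sum.distrib)
    qed
    ultimately have "((\<lambda>q. \<Sum>b\<in>Basis. (Y q \<bullet> b) *\<^sub>R F' q b) has_derivative
        (\<lambda>h. F'' (Y p) h + F' p (differential ?S Y p h))) (at p within ?S)"
      by simp
    moreover have eq: "(\<Sum>b\<in>Basis. (Y q \<bullet> b) *\<^sub>R F' q b) = differential ?S f q (Y q)" if "q \<in> ?S" "q \<in> U" for q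
      using frechet_derivative_sum_Basis[OF F'[OF that(2)], of "Y q"] dF[OF that]
        vector_field_tangent[OF Y that(1)] by simp
    have "\<forall>\<^sub>F q in at p within ?S. (\<Sum>b\<in>Basis. (Y q \<bullet> b) *\<^sub>R F' q b) = differential ?S f q (Y q)"
      unfolding eventually_at_filter eventually_nhds using U(1,2) eq by blast
    ultimately have "((\<lambda>q. differential ?S f q (Y q)) has_derivative
        (\<lambda>h. F'' (Y p) h + F' p (differential ?S Y p h))) (at p within ?S)"
      by (rule has_derivative_transform_eventually) (rule eq[OF p U(2)], rule p)
    from differential_eq[OF x this]
    have 1: "differential ?S (\<lambda>q. differential ?S f q (Y q)) p x
        = F'' (Y p) x + F' p (differential ?S Y p x)" .
    have "(differential ?S Y p x + (x \<bullet> Y p) *\<^sub>R p) \<bullet> p = 0"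
      using vector_field_sphere_deriv[OF Y p x] p
      by (simp add: inner_add_left dot_square_norm inner_commute[of x])
    then have "differential ?S Y p x + (x \<bullet> Y p) *\<^sub>R p \<in> tangent_space ?S p"
      using p by (simp add: tangent_space_sphere)
    from dF[OF p U(2) this] show ?thesis
      unfolding 1 K_def by (simp add: linear_add[OF linF] linear_cmul[OF linF])
  qed
  ultimately show ?thesis
    by (rule that)
qed

section \<open>First and second derivatives of a unit geodesic field\<close>

locale unit_geodesic_sphere_field =
  fixes \<xi> :: "'a::euclidean_space \<Rightarrow> 'a"
  assumes unit: "unit_vector_field unit_sphere round_metric \<xi>"
    and geodesic: "geodesic_field unit_sphere round_metric \<xi>"
begin

abbreviation d :: "'a \<Rightarrow> 'a \<Rightarrow> 'a" where "d \<equiv> differential unit_sphere \<xi>"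

text \<open>
  On \<open>T\<^sub>p\<close> the operator \<open>nab p\<close> is \<open>X \<mapsto> \<nabla>\<^sub>X\<xi>\<close>, and \<open>hess p x y\<close> is the derivative in direction
  \<open>x\<close> of \<open>q \<mapsto> d q (Y q)\<close> for a field \<open>Y\<close> with \<open>Y p = y\<close> and \<open>\<nabla>Y = 0\<close> at \<open>p\<close>.
\<close>

definition nab :: "'a \<Rightarrow> 'a \<Rightarrow> 'a" where "nab p x = d p x + (x \<bullet> \<xi> p) *\<^sub>R p"

definition hess :: "'a \<Rightarrow> 'a \<Rightarrow> 'a \<Rightarrow> 'a" where
  "hess p x y = differential unit_sphere (\<lambda>q. d q (y - (y \<bullet> q) *\<^sub>R q)) p x"

lemma field: "vector_field unit_sphere \<xi>" and smooth: "smooth_map unit_sphere \<xi>"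
  using unit by (auto simp: unit_vector_field_def vector_field_def)

lemma field_norm: "p \<in> unit_sphere \<Longrightarrow> \<xi> p \<bullet> \<xi> p = 1"
  using unit by (simp add: unit_vector_field_def round_metric_def)

lemma field_orth: "p \<in> unit_sphere \<Longrightarrow> \<xi> p \<bullet> p = 0"
  using vector_field_sphere_orthogonal[OF field] .

lemma field_tangent: "p \<in> unit_sphere \<Longrightarrow> \<xi> p \<in> tangent_space unit_sphere p"
  using vector_field_tangent[OF field] .

lemma linear_d: "p \<in> unit_sphere \<Longrightarrow> linear (d p)"
  using smooth_map_has_derivative[OF smooth] has_derivative_linear by blast

text \<open>The integral curves are great circles, and the ambient acceleration of a great circle is
  minus its position.\<close>

lemma d_field: "p \<in> unit_sphere \<Longrightarrow> d p (\<xi> p) = - p"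
  using geodesic levi_civita_sphere[OF field field, of p]
  by (simp add: geodesic_field_def field_norm add_eq_0_iff2)

lemma d_inner_base:
  assumes "p \<in> unit_sphere" "x \<in> tangent_space unit_sphere p"
  shows "d p x \<bullet> p = - (x \<bullet> \<xi> p)"
  using vector_field_sphere_deriv[OF field assms] by (simp add: inner_commute[of x])

lemma d_inner_field:
  assumes "p \<in> unit_sphere" "x \<in> tangent_space unit_sphere p"
  shows "d p x \<bullet> \<xi> p = 0"
proof -
  have "((\<lambda>q. \<xi> q \<bullet> \<xi> q) has_derivative (\<lambda>h. \<xi> p \<bullet> d p h + d p h \<bullet> \<xi> p)) (at p within unit_sphere)"
    by (rule derivative_eq_intros smooth_map_has_derivative[OF smooth] assms refl)+
  from has_derivative_tangent_eq_0[OF assms(2) this, of 1] assms(1) show ?thesis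
    by (simp add: field_norm inner_commute)
qed

lemma tangent_iff: "(p::'a) \<in> unit_sphere \<Longrightarrow> x \<in> tangent_space unit_sphere p \<longleftrightarrow> x \<bullet> p = 0"
  by (simp add: tangent_space_sphere)

lemma nab_tangent:
  assumes "p \<in> unit_sphere" "x \<in> tangent_space unit_sphere p"
  shows "nab p x \<in> tangent_space unit_sphere p"
  using assms d_inner_base[OF assms]
  by (simp add: tangent_iff nab_def inner_add_left dot_square_norm)

lemma nab_inner_field:
  assumes "p \<in> unit_sphere" "x \<in> tangent_space unit_sphere p"
  shows "nab p x \<bullet> \<xi> p = 0"
  using assms d_inner_field[OF assms] field_orth
  by (simp add: nab_def inner_add_left inner_commute[of p])

lemma nab_field: "p \<in> unit_sphere \<Longrightarrow> nab p (\<xi> p) = 0"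
  by (simp add: nab_def d_field field_norm)

lemma linear_nab:
  assumes "p \<in> unit_sphere"
  shows "linear (nab p)"
  unfolding nab_def
  by (rule linearI)
    (auto simp: linear_add[OF linear_d[OF assms]] linear_cmul[OF linear_d[OF assms]] inner_add_left algebra_simps)

lemma smooth_d: "vector_field unit_sphere Y \<Longrightarrow> smooth_map unit_sphere (\<lambda>q. d q (Y q))"
  using smooth_map_differential[OF smooth vector_field_smooth] vector_field_tangent by blast

text \<open>The projected constant field in \<open>hess\<close> is parallel at \<open>p\<close>, so
  the first-order term of the second derivative drops out. The identification with the bilinear form
  \<open>K\<close> holds on tangent vectors, which is why the rules for \<open>hess\<close> assume
  tangency.\<close>

lemma hess_K:
  assumes p: "p \<in> unit_sphere"
  obtains K where "bilinear K" "\<And>x y. K x y = K y x"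
    "\<And>x y. x \<in> tangent_space unit_sphere p \<Longrightarrow> y \<in> tangent_space unit_sphere p \<Longrightarrow> hess p x y = K x y"
    "\<And>Y x. vector_field unit_sphere Y \<Longrightarrow> x \<in> tangent_space unit_sphere p \<Longrightarrow>
      differential unit_sphere (\<lambda>q. d q (Y q)) p x =
        K x (Y p) + d p (differential unit_sphere Y p x + (x \<bullet> Y p) *\<^sub>R p)"
proof (rule sphere_second_derivative[OF smooth p], goal_cases)
  case (1 K)
  note K = 1(2-)
  have "hess p x y = K x y" if x: "x \<in> tangent_space unit_sphere p" and y: "y \<in> tangent_space unit_sphere p" for x y
  proof -
    let ?Y = "\<lambda>q. y - (y \<bullet> q) *\<^sub>R q"
    have y0: "y \<bullet> p = 0" using y p by (simp add: tangent_iff)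
    have "(?Y has_derivative (\<lambda>h. - ((y \<bullet> p) *\<^sub>R h + (y \<bullet> h) *\<^sub>R p))) (at p within unit_sphere)"
      by (auto intro!: derivative_eq_intros)
    from differential_eq[OF x this] have "differential unit_sphere ?Y p x + (x \<bullet> ?Y p) *\<^sub>R p = 0"
      by (simp add: y0 inner_commute[of x])
    with K(3)[OF vector_field_sphere_projection x, of y] show ?thesis
      by (simp add: hess_def y0 linear_0[OF linear_d[OF p]])
  qed
  then show ?case
    by (rule 1(1)[OF K(1,2) _ K(3)])
qed

lemma hess_deriv:
  assumes "p \<in> unit_sphere" "x \<in> tangent_space unit_sphere p" "vector_field unit_sphere Y"
  shows "differential unit_sphere (\<lambda>q. d q (Y q)) p x =
    hess p x (Y p) + d p (differential unit_sphere Y p x + (x \<bullet> Y p) *\<^sub>R p)"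
proof (rule hess_K[OF assms(1)], goal_cases)
  case (1 K)
  note K = 1
  show ?case
    using assms vector_field_tangent[OF assms(3,1)] by (simp add: K(3,4))
qed

lemma hess_commute:
  assumes "p \<in> unit_sphere" "x \<in> tangent_space unit_sphere p" "y \<in> tangent_space unit_sphere p"
  shows "hess p x y = hess p y x"
proof (rule hess_K[OF assms(1)], goal_cases)
  case (1 K)
  note K = 1
  show ?case
    using assms by (simp add: K(3) K(2)[of x])
qed

lemma hess_add_left:
  assumes "p \<in> unit_sphere" "x \<in> tangent_space unit_sphere p" "x' \<in> tangent_space unit_sphere p"
    "y \<in> tangent_space unit_sphere p"
  shows "hess p (x + c *\<^sub>R x') y = hess p x y + c *\<^sub>R hess p x' y"
proof (rule hess_K[OF assms(1)], goal_cases)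
  case (1 K)
  note K = 1
  have "x + c *\<^sub>R x' \<in> tangent_space unit_sphere p"
    using assms by (simp add: tangent_iff inner_add_left)
  with assms show ?case
    by (simp add: K(3) bilinear_ladd[OF K(1)] bilinear_lmul[OF K(1)])
qed

text \<open>Obtained by differentiating the geodesic equation \<open>d q (\<xi> q) = - q\<close>.
  Since \<open>nab p x\<close> is orthogonal to \<open>\<xi> p\<close>, the term
  \<open>d p (nab p x)\<close> is the square of \<open>nab p\<close> at \<open>x\<close>.\<close>

lemma hess_field:
  assumes p: "p \<in> unit_sphere" and x: "x \<in> tangent_space unit_sphere p"
  shows "hess p x (\<xi> p) = - x - d p (nab p x)"
proof -
  have "((\<lambda>q. - q) has_derivative (\<lambda>h. - h)) (at p within unit_sphere)"
    by (auto intro!: derivative_eq_intros)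
  then have "((\<lambda>q. d q (\<xi> q)) has_derivative (\<lambda>h. - h)) (at p within unit_sphere)"
    by (rule has_derivative_transform[OF p, rotated]) (simp add: d_field)
  from differential_eq[OF x this] hess_deriv[OF p x field] show ?thesis
    by (simp add: nab_def algebra_simps)
qed

text \<open>Differentiation of \<open>d q (Y q) \<bullet> q = - (y \<bullet> \<xi> q)\<close> and of
  \<open>d q (Y q) \<bullet> \<xi> q = 0\<close>, for \<open>Y\<close> the projected constant field
  of \<open>y\<close>. These components explain the multiples of \<open>p\<close> and
  \<open>\<xi> p\<close> in the condition for total geodesy.\<close>

lemma hess_inner:
  assumes p: "p \<in> unit_sphere" and x: "x \<in> tangent_space unit_sphere p" and y: "y \<in> tangent_space unit_sphere p"
  shows "hess p x y \<bullet> p = - (d p y \<bullet> x + y \<bullet> d p x)" "hess p x y \<bullet> \<xi> p = - (d p x \<bullet> d p y)"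
proof -
  let ?S = "unit_sphere :: 'a set" and ?Y = "\<lambda>q. y - (y \<bullet> q) *\<^sub>R q"
  have y0: "y \<bullet> p = 0" using y p by (simp add: tangent_iff)
  note vY = vector_field_sphere_projection[of y]
  note dd = smooth_map_has_derivative[OF smooth_d[OF vY] p]
  note d\<xi> = smooth_map_has_derivative[OF smooth p]
  have "((\<lambda>q. d q (?Y q) \<bullet> q) has_derivative
      (\<lambda>h. d p (?Y p) \<bullet> h + differential ?S (\<lambda>q. d q (?Y q)) p h \<bullet> p)) (at p within ?S)"
    by (rule derivative_eq_intros dd refl)+
  moreover have "((\<lambda>q. y \<bullet> \<xi> q) has_derivative (\<lambda>h. y \<bullet> d p h)) (at p within ?S)"
    by (auto intro!: derivative_eq_intros d\<xi>)
  ultimately have D: "((\<lambda>q. d q (?Y q) \<bullet> q + y \<bullet> \<xi> q) has_derivative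
      (\<lambda>h. d p (?Y p) \<bullet> h + differential ?S (\<lambda>q. d q (?Y q)) p h \<bullet> p + y \<bullet> d p h)) (at p within ?S)"
    by (rule has_derivative_add)
  have "d q (?Y q) \<bullet> q + y \<bullet> \<xi> q = 0" if "q \<in> ?S" for q
    using d_inner_base[OF that vector_field_tangent[OF vY that]] field_orth[OF that]
    by (simp add: inner_diff_left inner_commute[of q])
  then have "d p (?Y p) \<bullet> x + differential ?S (\<lambda>q. d q (?Y q)) p x \<bullet> p + y \<bullet> d p x = 0"
    by (rule has_derivative_tangent_eq_0[OF x D _ p])
  then show "hess p x y \<bullet> p = - (d p y \<bullet> x + y \<bullet> d p x)"
    by (simp add: hess_def y0)
  have "((\<lambda>q. d q (?Y q) \<bullet> \<xi> q) has_derivative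
      (\<lambda>h. d p (?Y p) \<bullet> d p h + differential ?S (\<lambda>q. d q (?Y q)) p h \<bullet> \<xi> p)) (at p within ?S)"
    by (rule derivative_eq_intros dd d\<xi> refl)+
  then have "d p (?Y p) \<bullet> d p x + differential ?S (\<lambda>q. d q (?Y q)) p x \<bullet> \<xi> p = 0"
    by (rule has_derivative_tangent_eq_0[OF x _ _ p]) (rule d_inner_field[OF _ vector_field_tangent[OF vY]])
  then show "hess p x y \<bullet> \<xi> p = - (d p x \<bullet> d p y)"
    by (simp add: hess_def y0 inner_commute[of "d p x"])
qed

end

context unit_geodesic_sphere_field
begin

section \<open>Geometry of the image of the field\<close>

lemma section_mem: "p \<in> unit_sphere \<Longrightarrow> (p, \<xi> p) \<in> unit_tangent_sphere"
  using field_norm[of p] field_orth[of p] by (simp add: unit_tangent_sphere_iff norm_eq_1)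

lemma section_mem_image: "p \<in> unit_sphere \<Longrightarrow> (p, \<xi> p) \<in> field_image unit_sphere \<xi>"
  by (simp add: field_image_def)

lemma ball_field_image: "(\<forall>P\<in>field_image M \<xi>. Q P) \<longleftrightarrow> (\<forall>p\<in>M. Q (p, \<xi> p))"
  by (auto simp: field_image_def)

lemma smooth_section: "smooth_map unit_sphere (\<lambda>q. (q, \<xi> q))"
  by (intro smooth_map_intros smooth)

lemma section_has_derivative:
  assumes "p \<in> unit_sphere"
  shows "((\<lambda>q. (q, \<xi> q)) has_derivative (\<lambda>h. (h, d p h))) (at p within unit_sphere)"
  using has_derivative_Pair[OF has_derivative_ident smooth_map_has_derivative[OF smooth assms]] .

text \<open>The image is a graph. Tangent vectors project to the sphere and satisfy the derivative
  of \<open>snd P = \<xi> (fst P)\<close>; conversely, the section pushes tangent vectors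
  forward.\<close>

lemma tangent_space_field_image:
  assumes p: "p \<in> unit_sphere"
  shows "tangent_space (field_image unit_sphere \<xi>) (p, \<xi> p)
    = (\<lambda>a. (a, d p a)) ` tangent_space unit_sphere p" (is "tangent_space ?N ?Q = _")
proof (intro equalityI subsetI)
  fix A assume A: "A \<in> tangent_space ?N ?Q"
  have fN: "fst ` ?N = unit_sphere"
    by (force simp: field_image_def)
  have f: "(fst has_derivative fst) (at ?Q within ?N)"
    by (auto intro!: derivative_eq_intros)
  have "differential ?N fst ?Q A \<in> tangent_space unit_sphere (fst ?Q)"
    by (rule differential_in_tangent_space[OF smooth_map_fst[OF smooth_map_id] _ section_mem_image[OF p] A])
      (use fN in blast)
  then have a: "fst A \<in> tangent_space unit_sphere p"
    using differential_eq[OF A f] by simp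
  have "(\<xi> has_derivative d p) (at (fst ?Q) within fst ` ?N)"
    unfolding fN using smooth_map_has_derivative[OF smooth p] by simp
  from has_derivative_diff[OF has_derivative_snd[OF has_derivative_ident] has_derivative_in_compose[OF f this]]
  have "snd A - d p (fst A) = 0"
    by (rule has_derivative_tangent_eq_0[OF A _ _ section_mem_image[OF p], where c = 0])
      (auto simp: field_image_def)
  then have "A = (fst A, d p (fst A))"
    by (simp add: prod_eq_iff)
  with a show "A \<in> (\<lambda>a. (a, d p a)) ` tangent_space unit_sphere p"
    by blast
next
  fix A assume "A \<in> (\<lambda>a. (a, d p a)) ` tangent_space unit_sphere p"
  then obtain a where a: "a \<in> tangent_space unit_sphere p" and A: "A = (a, d p a)"
    by blast
  have "differential unit_sphere (\<lambda>q. (q, \<xi> q)) p a \<in> tangent_space ?N ?Q"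
    by (rule differential_in_tangent_space[OF smooth_section _ p a]) (auto simp: field_image_def)
  then show "A \<in> tangent_space ?N ?Q"
    using differential_eq[OF a section_has_derivative[OF p]] by (simp add: A)
qed

text \<open>
  Vanishing of the second fundamental form of the image of \<open>\<xi>\<close> at \<open>(p, \<xi> p)\<close> on the lifts of
  \<open>x\<close> and \<open>y\<close>.
\<close>

definition tg_cond :: "'a \<Rightarrow> 'a \<Rightarrow> 'a \<Rightarrow> bool" where
  "tg_cond p x y \<longleftrightarrow> hess p x y
    + (d p x \<bullet> d p y - (x \<bullet> \<xi> p) * (y \<bullet> \<xi> p)) *\<^sub>R \<xi> p
    + (y \<bullet> d p x + x \<bullet> d p y) *\<^sub>R p
    + (1/2) *\<^sub>R ((x \<bullet> \<xi> p) *\<^sub>R (y + d p (nab p y)) + (y \<bullet> \<xi> p) *\<^sub>R (x + d p (nab p x))) = 0"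

text \<open>A field tangent to the image is determined there by its first component
  \<open>y\<close>, a field on the sphere, so its derivative along a lift is that of the pair
  \<open>y\<close>, \<open>d q (y q)\<close>. The vector \<open>e\<close> is the ambient derivative
  of \<open>y\<close>: its normal part is known, its tangential part is not.\<close>

lemma differential_along_field:
  fixes Y :: "'a \<times> 'a \<Rightarrow> 'a \<times> 'a"
  assumes Y: "vector_field unit_tangent_sphere Y" and p: "p \<in> unit_sphere"
    and YN: "\<And>P. P \<in> field_image unit_sphere \<xi> \<Longrightarrow> Y P \<in> tangent_space (field_image unit_sphere \<xi>) P"
    and x: "x \<in> tangent_space unit_sphere p"
  shows "\<exists>e. differential unit_tangent_sphere Y (p, \<xi> p) (x, d p x)
      = (e, hess p x (fst (Y (p, \<xi> p))) + d p (e + (x \<bullet> fst (Y (p, \<xi> p))) *\<^sub>R p))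
    \<and> e \<bullet> p + fst (Y (p, \<xi> p)) \<bullet> x = 0"
proof -
  let ?S = "unit_sphere :: 'a set"
  define y where "y q = fst (Y (q, \<xi> q))" for q
  have Yq: "Y (q, \<xi> q) = (y q, d q (y q))" "y q \<in> tangent_space ?S q" if "q \<in> ?S" for q
    using YN[OF section_mem_image[OF that]] by (auto simp: tangent_space_field_image[OF that] y_def)
  have img: "(\<lambda>q. (q, \<xi> q)) ` ?S \<subseteq> unit_tangent_sphere"
    using section_mem by blast
  have "smooth_map ?S y"
    unfolding y_def
    by (rule smooth_map_fst[OF smooth_map_compose[OF vector_field_smooth[OF Y] smooth_section img]])
  with Yq(2) have y: "vector_field ?S y"
    by (simp add: vector_field_def)
  have "((\<lambda>q. Y (q, \<xi> q)) has_derivative (\<lambda>h. differential unit_tangent_sphere Y (p, \<xi> p) (h, d p h)))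
      (at p within ?S)"
    by (rule has_derivative_in_compose[OF section_has_derivative[OF p]
          has_derivative_subset[OF smooth_map_has_derivative[OF vector_field_smooth[OF Y] section_mem[OF p]] img]])
  moreover have "((\<lambda>q. Y (q, \<xi> q)) has_derivative
      (\<lambda>h. (differential ?S y p h, differential ?S (\<lambda>q. d q (y q)) p h))) (at p within ?S)"
    by (rule has_derivative_transform[OF p Yq(1)]) (assumption, rule has_derivative_Pair[OF
          smooth_map_has_derivative[OF vector_field_smooth[OF y] p] smooth_map_has_derivative[OF smooth_d[OF y] p]])
  ultimately have "differential unit_tangent_sphere Y (p, \<xi> p) (x, d p x)
      = (differential ?S y p x, differential ?S (\<lambda>q. d q (y q)) p x)"
    by (rule has_derivative_unique_tangent[OF x])
  then show ?thesis
    using hess_deriv[OF p x y] vector_field_sphere_deriv[OF y p x] by (auto simp: y_def)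
qed

text \<open>A vector \<open>(u, s)\<close> with \<open>u\<close> tangent is tangent to the graph
  exactly when \<open>s = d p u\<close>. Subtracting \<open>d p u\<close> removes the unknown
  covariant derivative of the first component, so only values at the point remain.\<close>

lemma levi_civita_along_field:
  fixes X Y :: "'a \<times> 'a \<Rightarrow> 'a \<times> 'a"
  assumes X: "vector_field unit_tangent_sphere X" and Y: "vector_field unit_tangent_sphere Y"
    and p: "p \<in> unit_sphere"
    and XN: "\<And>P. P \<in> field_image unit_sphere \<xi> \<Longrightarrow> X P \<in> tangent_space (field_image unit_sphere \<xi>) P"
    and YN: "\<And>P. P \<in> field_image unit_sphere \<xi> \<Longrightarrow> Y P \<in> tangent_space (field_image unit_sphere \<xi>) P"
  shows "levi_civita unit_tangent_sphere (sasaki_metric unit_sphere round_metric) X Y (p, \<xi> p)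
      \<in> tangent_space (field_image unit_sphere \<xi>) (p, \<xi> p)
    \<longleftrightarrow> tg_cond p (fst (X (p, \<xi> p))) (fst (Y (p, \<xi> p)))"
proof -
  let ?Q = "(p, \<xi> p)"
  define x where "x = fst (X ?Q)"
  define y where "y = fst (Y ?Q)"
  have XQ: "X ?Q = (x, d p x)" and x: "x \<in> tangent_space unit_sphere p"
    using XN[OF section_mem_image[OF p]] by (auto simp: tangent_space_field_image[OF p] x_def)
  have YQ: "Y ?Q = (y, d p y)" and y: "y \<in> tangent_space unit_sphere p"
    using YN[OF section_mem_image[OF p]] by (auto simp: tangent_space_field_image[OF p] y_def)
  obtain e where e: "differential unit_tangent_sphere Y ?Q (x, d p x)
      = (e, hess p x y + d p (e + (x \<bullet> y) *\<^sub>R p))" "e \<bullet> p + y \<bullet> x = 0"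
    using differential_along_field[OF Y p YN x] unfolding y_def by blast
  define t where "t = y \<bullet> d p x + x \<bullet> d p y"
  define a where "a = x \<bullet> \<xi> p"
  define b where "b = y \<bullet> \<xi> p"
  define w where "w = e + (x \<bullet> y) *\<^sub>R p"
  \<comment> \<open>This is the first component of the connection. Writing it with
    \<open>nab\<close> in place of \<open>d\<close> absorbs the multiple \<open>- (a * b)\<close> of
    \<open>p\<close>, which makes tangency visible.\<close>
  define u where "u = w + ((t / 2) *\<^sub>R \<xi> p - (1/2) *\<^sub>R (a *\<^sub>R nab p y + b *\<^sub>R nab p x))"
  have w0: "w \<bullet> p = 0"
    using e(2) p by (simp add: w_def inner_add_left dot_square_norm inner_commute[of x])
  have u0: "u \<in> tangent_space unit_sphere p"
    using nab_tangent[OF p x] nab_tangent[OF p y] w0 p field_orth[OF p]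
    by (simp add: tangent_iff[OF p] u_def inner_add_left inner_diff_left)
  have half: "(r / 2) *\<^sub>R p + (r / 2) *\<^sub>R p = r *\<^sub>R p" for r
    by (simp flip: scaleR_add_left)
  have LC: "levi_civita unit_tangent_sphere (sasaki_metric unit_sphere round_metric) X Y ?Q
    = (u, hess p x y + d p w + (d p x \<bullet> d p y - a * b) *\<^sub>R \<xi> p + (t / 2) *\<^sub>R p + (1/2) *\<^sub>R (a *\<^sub>R y + b *\<^sub>R x))"
    unfolding levi_civita_sasaki[OF X Y section_mem[OF p]] XQ YQ e(1) sasaki_christoffel_simp
      a_def[symmetric] b_def[symmetric] t_def[symmetric] w_def[symmetric]
    by (simp add: u_def w_def nab_def a_def b_def half algebra_simps)
  \<comment> \<open>The geodesic equation \<open>d p (\<xi> p) = - p\<close> turns the multiple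
    \<open>t / 2\<close> of \<open>\<xi> p\<close> into one of \<open>- p\<close>, which later adds
    to the other half.\<close>
  have du: "d p u = d p w - (t / 2) *\<^sub>R p - (1/2) *\<^sub>R (a *\<^sub>R d p (nab p y) + b *\<^sub>R d p (nab p x))"
    unfolding u_def using linear_d[OF p] d_field[OF p]
    by (simp add: linear_add linear_diff linear_cmul)
  have "levi_civita unit_tangent_sphere (sasaki_metric unit_sphere round_metric) X Y ?Q
      \<in> tangent_space (field_image unit_sphere \<xi>) ?Q \<longleftrightarrow>
    hess p x y + d p w + (d p x \<bullet> d p y - a * b) *\<^sub>R \<xi> p + (t / 2) *\<^sub>R p + (1/2) *\<^sub>R (a *\<^sub>R y + b *\<^sub>R x) - d p u = 0"
    unfolding tangent_space_field_image[OF p] LC using u0 by auto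
  also have "hess p x y + d p w + (d p x \<bullet> d p y - a * b) *\<^sub>R \<xi> p + (t / 2) *\<^sub>R p + (1/2) *\<^sub>R (a *\<^sub>R y + b *\<^sub>R x) - d p u
    = hess p x y + (d p x \<bullet> d p y - a * b) *\<^sub>R \<xi> p + ((t / 2) *\<^sub>R p + (t / 2) *\<^sub>R p)
      + (1/2) *\<^sub>R (a *\<^sub>R (y + d p (nab p y)) + b *\<^sub>R (x + d p (nab p x)))"
    unfolding du by (simp add: algebra_simps)
  also have "(t / 2) *\<^sub>R p + (t / 2) *\<^sub>R p = t *\<^sub>R p"
    by (rule half)
  finally show ?thesis
    unfolding tg_cond_def x_def[symmetric] y_def[symmetric] t_def[symmetric] a_def[symmetric] b_def[symmetric] .
qed

text \<open>Total geodesy is tested on fields of the whole unit tangent bundle, so each tangent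
  vector of the image must extend to such a field that stays tangent along the image.\<close>

lemma tangent_extension:
  assumes p: "p \<in> unit_sphere" and x: "x \<in> tangent_space unit_sphere p"
  shows "\<exists>X. vector_field unit_tangent_sphere X \<and>
    (\<forall>P\<in>field_image unit_sphere \<xi>. X P \<in> tangent_space (field_image unit_sphere \<xi>) P) \<and>
    fst (X (p, \<xi> p)) = x"
proof -
  define a where "a q = x - (x \<bullet> q) *\<^sub>R q" for q
  have va: "vector_field unit_sphere a"
    unfolding a_def by (rule vector_field_sphere_projection)
  define w where "w P = d (fst P) (a (fst P))" for P :: "'a \<times> 'a"
  \<comment> \<open>The lift \<open>(a, d q a)\<close> is corrected at a general
    \<open>(q, v)\<close> so that the tangency equations hold. For \<open>v = \<xi> q\<close> the
    corrections cancel, by \<open>d_inner_base\<close> and \<open>d_inner_field\<close>.\<close>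
  define X where "X P = (a (fst P), w P - (w P \<bullet> snd P) *\<^sub>R snd P - (w P \<bullet> fst P) *\<^sub>R fst P
    - (a (fst P) \<bullet> snd P) *\<^sub>R fst P)" for P
  have img: "fst ` unit_tangent_sphere \<subseteq> (unit_sphere :: 'a set)"
    by (auto simp: unit_tangent_sphere_iff)
  have sa: "smooth_map unit_tangent_sphere (\<lambda>P. a (fst P))"
    by (rule smooth_map_compose[OF vector_field_smooth[OF va] smooth_map_fst[OF smooth_map_id] img])
  have sw: "smooth_map unit_tangent_sphere w"
    unfolding w_def by (rule smooth_map_compose[OF smooth_d[OF va] smooth_map_fst[OF smooth_map_id] img])
  have "vector_field unit_tangent_sphere X"
    unfolding vector_field_def
  proof (intro conjI ballI)
    show "smooth_map unit_tangent_sphere X"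
      unfolding X_def by (intro smooth_map_intros sa sw)
    fix P assume "P \<in> (unit_tangent_sphere :: ('a \<times> 'a) set)"
    then obtain q v where P: "P = (q, v)" "(q, v) \<in> unit_tangent_sphere"
      by (metis surj_pair)
    then have q: "q \<in> unit_sphere" and u: "v \<bullet> v = 1" "q \<bullet> q = 1" "v \<bullet> q = 0" "q \<bullet> v = 0"
      by (auto simp: unit_tangent_sphere_iff dot_square_norm inner_commute)
    show "X P \<in> tangent_space unit_tangent_sphere P"
      unfolding P(1) tangent_space_unit_tangent_sphere[OF P(2)]
      using vector_field_sphere_orthogonal[OF va q] u by (simp add: X_def inner_diff_left)
  qed
  moreover have "fst (X (p, \<xi> p)) = x"
    using x by (simp add: X_def a_def tangent_iff[OF p])
  moreover have "X (q, \<xi> q) \<in> tangent_space (field_image unit_sphere \<xi>) (q, \<xi> q)"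
    if q: "q \<in> unit_sphere" for q
  proof -
    note t = vector_field_tangent[OF va q]
    have "X (q, \<xi> q) = (a q, d q (a q))"
      using d_inner_base[OF q t] d_inner_field[OF q t] by (simp add: X_def w_def)
    with t show ?thesis
      unfolding tangent_space_field_image[OF q] by auto
  qed
  ultimately show ?thesis
    unfolding ball_field_image by blast
qed

text \<open>The second fundamental form depends on the values of the fields at the point only, and
  \<open>tangent_extension\<close> realises every pair of values.\<close>

lemma totally_geodesic_iff:
  "totally_geodesic_field unit_sphere round_metric \<xi> \<longleftrightarrow>
    (\<forall>p\<in>unit_sphere. \<forall>x\<in>tangent_space unit_sphere p. \<forall>y\<in>tangent_space unit_sphere p. tg_cond p x y)"
  (is "?L \<longleftrightarrow> ?R")
proof
  assume L: ?L
  show ?R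
  proof (intro ballI)
    fix p x y :: 'a
    assume p: "p \<in> unit_sphere" and x: "x \<in> tangent_space unit_sphere p" and y: "y \<in> tangent_space unit_sphere p"
    obtain X where X: "vector_field unit_tangent_sphere X"
      "\<And>P. P \<in> field_image unit_sphere \<xi> \<Longrightarrow> X P \<in> tangent_space (field_image unit_sphere \<xi>) P"
      "fst (X (p, \<xi> p)) = x"
      using tangent_extension[OF p x] by blast
    obtain Y where Y: "vector_field unit_tangent_sphere Y"
      "\<And>P. P \<in> field_image unit_sphere \<xi> \<Longrightarrow> Y P \<in> tangent_space (field_image unit_sphere \<xi>) P"
      "fst (Y (p, \<xi> p)) = y"
      using tangent_extension[OF p y] by blast
    have "levi_civita unit_tangent_sphere (sasaki_metric unit_sphere round_metric) X Y (p, \<xi> p)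
        \<in> tangent_space (field_image unit_sphere \<xi>) (p, \<xi> p)"
      using L X Y section_mem_image[OF p]
      unfolding totally_geodesic_field_def totally_geodesic_submanifold_def by blast
    then show "tg_cond p x y"
      using levi_civita_along_field[OF X(1) Y(1) p X(2) Y(2)] X(3) Y(3) by simp
  qed
next
  assume R: ?R
  have "levi_civita unit_tangent_sphere (sasaki_metric unit_sphere round_metric) X Y P
      \<in> tangent_space (field_image unit_sphere \<xi>) P"
    if XY: "vector_field unit_tangent_sphere X" "vector_field unit_tangent_sphere Y"
      and N: "\<forall>P\<in>field_image unit_sphere \<xi>. X P \<in> tangent_space (field_image unit_sphere \<xi>) P \<and>
        Y P \<in> tangent_space (field_image unit_sphere \<xi>) P"
      and P: "P \<in> field_image unit_sphere \<xi>" for X Y P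
  proof -
    obtain p where p: "p \<in> unit_sphere" "P = (p, \<xi> p)"
      using P by (auto simp: field_image_def)
    have "fst (X P) \<in> tangent_space unit_sphere p" "fst (Y P) \<in> tangent_space unit_sphere p"
      using bspec[OF N P] unfolding p(2) tangent_space_field_image[OF p(1)] by auto
    with R p levi_civita_along_field[OF XY p(1)] N show ?thesis
      by blast
  qed
  then show ?L
    unfolding totally_geodesic_field_def totally_geodesic_submanifold_def
    using section_mem by (auto simp: field_image_def)
qed

section \<open>Strong normality and invariance as pointwise conditions\<close>

lemma strongly_normal_iff:
  "strongly_normal unit_sphere round_metric \<xi> \<longleftrightarrow>
    (\<forall>p\<in>unit_sphere. \<forall>x y z. x \<bullet> p = 0 \<longrightarrow> y \<bullet> p = 0 \<longrightarrow> z \<bullet> p = 0 \<longrightarrow>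
      x \<bullet> \<xi> p = 0 \<longrightarrow> y \<bullet> \<xi> p = 0 \<longrightarrow> z \<bullet> \<xi> p = 0 \<longrightarrow> hess p x y \<bullet> z = 0)"
  (is "?L \<longleftrightarrow> ?R")
proof -
  \<comment> \<open>For \<open>Y\<close> orthogonal to \<open>\<xi>\<close> everywhere, the
    covariant derivative of \<open>\<xi>\<close> along \<open>Y\<close> is \<open>d q (Y q)\<close>
    without correction. Differentiating again gives \<open>hess\<close> up to a multiple of
    \<open>p\<close>, which a tangent \<open>z\<close> does not see.\<close>
  have nabla: "nabla_A unit_sphere round_metric \<xi> X Y p \<bullet> z = - (hess p (X p) (Y p) \<bullet> z)"
    if X: "vector_field unit_sphere X" and Y: "vector_field unit_sphere Y"
      and Y0: "\<And>q. q \<in> unit_sphere \<Longrightarrow> Y q \<bullet> \<xi> q = 0"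
      and p: "p \<in> unit_sphere" and z: "z \<bullet> p = 0" for X Y p z
  proof -
    let ?V = "levi_civita unit_sphere round_metric Y \<xi>"
      and ?W = "levi_civita unit_sphere round_metric X Y"
    have V: "d q (Y q) = ?V q" if "q \<in> unit_sphere" for q
      using levi_civita_sphere[OF Y field that] Y0[OF that] by simp
    have "d q (Y q) \<bullet> q = 0" if "q \<in> unit_sphere" for q
      using d_inner_base[OF that vector_field_tangent[OF Y that]] Y0[OF that] by simp
    then have VF: "vector_field unit_sphere ?V"
      unfolding vector_field_def
      using smooth_map_cong[OF V smooth_d[OF Y]] V by (simp add: tangent_space_sphere)
    have W: "?W q = differential unit_sphere Y q (X q) + (X q \<bullet> Y q) *\<^sub>R q" if "q \<in> unit_sphere" for q
      by (rule levi_civita_sphere[OF X Y that])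
    have WF: "vector_field unit_sphere ?W"
      unfolding vector_field_def
    proof (intro conjI ballI)
      have "smooth_map unit_sphere (\<lambda>q. differential unit_sphere Y q (X q) + (X q \<bullet> Y q) *\<^sub>R q)"
        using X Y by (intro smooth_map_intros smooth_map_differential vector_field_smooth vector_field_tangent)
      then show "smooth_map unit_sphere ?W"
        by (rule smooth_map_cong[rotated]) (simp only: W)
      fix q :: 'a assume q: "q \<in> unit_sphere"
      then show "?W q \<in> tangent_space unit_sphere q"
        using vector_field_sphere_deriv[OF Y q vector_field_tangent[OF X q]] W[OF q]
        by (simp add: tangent_iff[OF q] inner_add_left dot_square_norm inner_commute[of "Y q"])
    qed
    have "levi_civita unit_sphere round_metric X ?V p
        = differential unit_sphere (\<lambda>q. d q (Y q)) p (X p) + (X p \<bullet> ?V p) *\<^sub>R p"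
      using levi_civita_sphere[OF X VF p]
        differential_cong[OF vector_field_tangent[OF X p] smooth_d[OF Y] p V] by simp
    moreover have "levi_civita unit_sphere round_metric ?W \<xi> p = d p (?W p) + (?W p \<bullet> \<xi> p) *\<^sub>R p"
      by (rule levi_civita_sphere[OF WF field p])
    ultimately have "levi_civita unit_sphere round_metric X ?V p
        - levi_civita unit_sphere round_metric ?W \<xi> p
      = hess p (X p) (Y p) + (X p \<bullet> ?V p - ?W p \<bullet> \<xi> p) *\<^sub>R p"
      using hess_deriv[OF p vector_field_tangent[OF X p] Y] W[OF p] by (simp add: algebra_simps)
    then show ?thesis
      using z by (simp add: nabla_A_def inner_add_left inner_diff_left inner_commute[of p])
  qed
  show ?thesis
  proof
    assume L: ?L
    show ?R
    proof (intro ballI allI impI)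
      fix p x y z :: 'a
      assume p: "p \<in> unit_sphere"
        and xyz: "x \<bullet> p = 0" "y \<bullet> p = 0" "z \<bullet> p = 0" "x \<bullet> \<xi> p = 0" "y \<bullet> \<xi> p = 0" "z \<bullet> \<xi> p = 0"
      \<comment> \<open>The constant field is projected off both \<open>q\<close> and
        \<open>\<xi> q\<close>: the hypotheses of strong normality demand orthogonality to
        \<open>\<xi>\<close> on the whole sphere.\<close>
      define X where "X x q = x - (x \<bullet> q) *\<^sub>R q - (x \<bullet> \<xi> q) *\<^sub>R \<xi> q" for x q
      have X0: "X x q \<bullet> \<xi> q = 0" if "q \<in> unit_sphere" for x q
        using field_norm[OF that] field_orth[OF that] by (simp add: X_def inner_diff_left inner_commute[of q])
      have XV: "vector_field unit_sphere (X x)" for x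
        unfolding vector_field_def
      proof (intro conjI ballI)
        show "smooth_map unit_sphere (X x)"
          unfolding X_def by (intro smooth_map_intros smooth)
        fix q :: 'a assume "q \<in> unit_sphere"
        then show "X x q \<in> tangent_space unit_sphere q"
          using field_orth[of q] by (simp add: tangent_space_sphere X_def inner_diff_left dot_square_norm)
      qed
      have "nabla_A unit_sphere round_metric \<xi> (X x) (X y) p \<bullet> X z p = 0"
        using L XV X0 p unfolding strongly_normal_def round_metric_def by blast
      moreover have "X x p = x" "X y p = y" "X z p = z"
        using xyz by (simp_all add: X_def)
      ultimately show "hess p x y \<bullet> z = 0"
        using nabla[OF XV XV X0 p xyz(3), of x y] by simp
    qed
  next
    assume R: ?R
    show ?L
      unfolding strongly_normal_def round_metric_def
    proof (intro allI impI ballI)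
      fix X Y Z and p :: 'a
      assume XYZ: "vector_field unit_sphere X" "vector_field unit_sphere Y" "vector_field unit_sphere Z"
        and o: "\<forall>p\<in>unit_sphere. X p \<bullet> \<xi> p = 0 \<and> Y p \<bullet> \<xi> p = 0 \<and> Z p \<bullet> \<xi> p = 0"
        and p: "p \<in> unit_sphere"
      have "nabla_A unit_sphere (\<lambda>p. (\<bullet>)) \<xi> X Y p \<bullet> Z p = - (hess p (X p) (Y p) \<bullet> Z p)"
        using nabla[OF XYZ(1,2) _ p vector_field_sphere_orthogonal[OF XYZ(3) p]] o
        unfolding round_metric_def[abs_def] by blast
      moreover have "hess p (X p) (Y p) \<bullet> Z p = 0"
        using R p o XYZ[THEN vector_field_sphere_orthogonal, OF p] by blast
      ultimately show "nabla_A unit_sphere (\<lambda>p. (\<bullet>)) \<xi> X Y p \<bullet> Z p = 0"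
        by simp
    qed
  qed
qed

text \<open>The vector has horizontal part \<open>a\<close> and vertical part
  \<open>nab p a\<close>, which the complex structure exchanges up to sign. As
  \<open>nab p a\<close> is orthogonal to \<open>\<xi> p\<close>, its horizontal lift has second
  component 0; the normal part to be removed is the \<open>\<xi> p\<close> component of
  \<open>a\<close>.\<close>

lemma contact_phi_section:
  assumes p: "p \<in> unit_sphere" and a: "a \<in> tangent_space unit_sphere p"
  shows "contact_phi unit_sphere round_metric (p, \<xi> p) (a, d p a)
    = (- nab p a, a - (a \<bullet> \<xi> p) *\<^sub>R \<xi> p)"
proof -
  have n: "norm p = 1" using p by simp
  have a0: "a \<bullet> p = 0" using a by (simp add: tangent_iff[OF p])
  have nt: "nab p a \<bullet> p = 0" using nab_tangent[OF p a] by (simp add: tangent_iff[OF p])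
  have "vcomp unit_sphere round_metric (p, \<xi> p) (a, d p a) = nab p a"
    by (simp add: vcomp_sphere[OF section_mem[OF p] a0] nab_def)
  then have J: "complex_structure unit_sphere round_metric (p, \<xi> p) (a, d p a) = (- nab p a, a)"
    using hlift_sphere[OF n field_orth[OF p] nt] nab_inner_field[OF p a]
    by (simp add: complex_structure_def vlift_def hcomp_def)
  show ?thesis
    unfolding contact_phi_def J tangent_space_unit_tangent_sphere[OF section_mem[OF p]]
  proof (rule the_equality)
    show "(- nab p a, a - (a \<bullet> \<xi> p) *\<^sub>R \<xi> p) \<in> {(a, b). a \<bullet> p = 0 \<and> b \<bullet> \<xi> p = 0 \<and> a \<bullet> \<xi> p + b \<bullet> p = 0} \<and>
      (\<exists>\<eta>. (- nab p a, a) = (- nab p a, a - (a \<bullet> \<xi> p) *\<^sub>R \<xi> p) + \<eta> *\<^sub>R vlift (p, \<xi> p) (snd (p, \<xi> p)))"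
      using nt nab_inner_field[OF p a] a0 field_norm[OF p] field_orth[OF p]
      by (auto simp: vlift_def inner_diff_left intro!: exI[of _ "a \<bullet> \<xi> p"])
  next
    fix B
    assume "B \<in> {(a, b). a \<bullet> p = 0 \<and> b \<bullet> \<xi> p = 0 \<and> a \<bullet> \<xi> p + b \<bullet> p = 0} \<and>
      (\<exists>\<eta>. (- nab p a, a) = B + \<eta> *\<^sub>R vlift (p, \<xi> p) (snd (p, \<xi> p)))"
    then have B: "snd B \<bullet> \<xi> p = 0" "\<exists>\<eta>. (- nab p a, a) = B + \<eta> *\<^sub>R vlift (p, \<xi> p) (snd (p, \<xi> p))"
      by auto
    then obtain \<eta> where "(- nab p a, a) = B + \<eta> *\<^sub>R vlift (p, \<xi> p) (snd (p, \<xi> p))"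
      by blast
    then have "B = (- nab p a, a - \<eta> *\<^sub>R \<xi> p)"
      by (cases B) (auto simp: vlift_def)
    with B(1) show "B = (- nab p a, a - (a \<bullet> \<xi> p) *\<^sub>R \<xi> p)"
      using field_norm[OF p] by (simp add: inner_diff_left)
  qed
qed

text \<open>The graph criterion for the vector found in \<open>contact_phi_section\<close>. At
  \<open>\<xi> p\<close> both sides are 0; on its complement the square of \<open>nab p\<close> is
  minus the identity.\<close>

lemma invariant_iff:
  "invariant_field unit_sphere round_metric \<xi> \<longleftrightarrow>
    (\<forall>p\<in>unit_sphere. \<forall>a\<in>tangent_space unit_sphere p. d p (nab p a) = (a \<bullet> \<xi> p) *\<^sub>R \<xi> p - a)"
proof -
  have "contact_phi unit_sphere round_metric (p, \<xi> p) (a, d p a)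
      \<in> tangent_space (field_image unit_sphere \<xi>) (p, \<xi> p) \<longleftrightarrow> d p (nab p a) = (a \<bullet> \<xi> p) *\<^sub>R \<xi> p - a"
    if p: "p \<in> unit_sphere" and a: "a \<in> tangent_space unit_sphere p" for p a
  proof -
    have "- nab p a \<in> tangent_space unit_sphere p"
      using nab_tangent[OF p a] by (simp add: tangent_iff[OF p])
    then have "contact_phi unit_sphere round_metric (p, \<xi> p) (a, d p a)
      \<in> tangent_space (field_image unit_sphere \<xi>) (p, \<xi> p) \<longleftrightarrow> a - (a \<bullet> \<xi> p) *\<^sub>R \<xi> p = - d p (nab p a)"
      unfolding contact_phi_section[OF p a] tangent_space_field_image[OF p]
      by (auto simp: linear_neg[OF linear_d[OF p]])
    then show ?thesis
      by (metis minus_diff_eq minus_minus)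
  qed
  then have "contact_phi unit_sphere round_metric (p, \<xi> p) ` tangent_space (field_image unit_sphere \<xi>) (p, \<xi> p)
      \<subseteq> tangent_space (field_image unit_sphere \<xi>) (p, \<xi> p) \<longleftrightarrow>
    (\<forall>a\<in>tangent_space unit_sphere p. d p (nab p a) = (a \<bullet> \<xi> p) *\<^sub>R \<xi> p - a)" if p: "p \<in> unit_sphere" for p
    using p by (subst (1) tangent_space_field_image[OF p]) (auto simp: image_subset_iff simp del: mem_sphere_0)
  then show ?thesis
    unfolding invariant_field_def ball_field_image by blast
qed

section \<open>Equivalence of the pointwise conditions\<close>

lemma totally_geodesic_iff_strongly_normal_invariant:
  "totally_geodesic_field unit_sphere round_metric \<xi> \<longleftrightarrow>
    strongly_normal unit_sphere round_metric \<xi> \<and> invariant_field unit_sphere round_metric \<xi>"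
  (is "?TG \<longleftrightarrow> ?SN \<and> ?I")
proof (intro iffI conjI)
  assume ?TG
  then have TG: "tg_cond p x y"
    if "p \<in> unit_sphere" "x \<in> tangent_space unit_sphere p" "y \<in> tangent_space unit_sphere p" for p x y
    using that unfolding totally_geodesic_iff by blast
  show ?SN
    unfolding strongly_normal_iff
  proof (intro ballI allI impI)
    fix p x y z :: 'a
    assume p: "p \<in> unit_sphere"
      and o: "x \<bullet> p = 0" "y \<bullet> p = 0" "z \<bullet> p = 0" "x \<bullet> \<xi> p = 0" "y \<bullet> \<xi> p = 0" "z \<bullet> \<xi> p = 0"
    have "tg_cond p x y"
      using TG[OF p] o by (simp add: tangent_iff[OF p])
    then have "hess p x y + (d p x \<bullet> d p y) *\<^sub>R \<xi> p + (y \<bullet> d p x + x \<bullet> d p y) *\<^sub>R p = 0"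
      by (simp add: tg_cond_def o)
    then have "(hess p x y + (d p x \<bullet> d p y) *\<^sub>R \<xi> p + (y \<bullet> d p x + x \<bullet> d p y) *\<^sub>R p) \<bullet> z = 0"
      by simp
    then show "hess p x y \<bullet> z = 0"
      using o(3,6) by (simp add: inner_add_left inner_commute[of p] inner_commute[of "\<xi> p"])
  qed
  show ?I
    unfolding invariant_iff
  proof (intro ballI)
    fix p a :: 'a
    assume p: "p \<in> unit_sphere" and a: "a \<in> tangent_space unit_sphere p"
    \<comment> \<open>Since \<open>nab p\<close> kills \<open>\<xi> p\<close>, projecting
      \<open>a\<close> leaves \<open>nab p a\<close> unchanged, and the condition at
      \<open>x\<close> and \<open>\<xi> p\<close> contains no further terms.\<close>
    define x where "x = a - (a \<bullet> \<xi> p) *\<^sub>R \<xi> p"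
    have x: "x \<in> tangent_space unit_sphere p" and x\<xi>: "x \<bullet> \<xi> p = 0"
      using a field_norm[OF p] field_orth[OF p]
      by (simp_all add: tangent_iff[OF p] x_def inner_diff_left)
    have nx: "nab p x = nab p a"
      using linear_nab[OF p] by (simp add: x_def linear_diff linear_cmul nab_field[OF p])
    have "d p x \<bullet> p = 0" "\<xi> p \<bullet> d p x = 0" "x \<bullet> p = 0"
      using d_inner_base[OF p x] d_inner_field[OF p x] x x\<xi> by (simp_all add: inner_commute[of "\<xi> p" "d p x"] tangent_iff[OF p])
    then have "- x - d p (nab p x) + (1/2) *\<^sub>R (x + d p (nab p x)) = 0"
      using TG[OF p x field_tangent[OF p]]
      by (simp add: tg_cond_def hess_field[OF p x] d_field[OF p] field_norm[OF p] x\<xi>)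
    \<comment> \<open>Half of a vector equals the whole, so the vector is 0.\<close>
    then have "(1/2) *\<^sub>R (x + d p (nab p x)) = 1 *\<^sub>R (x + d p (nab p x))"
      by (simp add: algebra_simps add_eq_0_iff2)
    then have "x + d p (nab p x) = 0"
      unfolding scaleR_cancel_right by simp
    then have "d p (nab p a) = - x"
      by (simp add: nx add_eq_0_iff)
    then show "d p (nab p a) = (a \<bullet> \<xi> p) *\<^sub>R \<xi> p - a"
      by (simp add: x_def)
  qed
next
  assume SI: "?SN \<and> ?I"
  have I: "d p (nab p a) = (a \<bullet> \<xi> p) *\<^sub>R \<xi> p - a"
    if "p \<in> unit_sphere" "a \<in> tangent_space unit_sphere p" for p a
    using SI that unfolding invariant_iff by blast
  show ?TG
    unfolding totally_geodesic_iff
  proof (intro ballI)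
    fix p x y :: 'a
    assume p: "p \<in> unit_sphere" and x: "x \<in> tangent_space unit_sphere p" and y: "y \<in> tangent_space unit_sphere p"
    note \<xi>t = field_tangent[OF p]
    define T where "T = (\<lambda>v. v - (v \<bullet> \<xi> p) *\<^sub>R \<xi> p)"
    have Tt: "T v \<in> tangent_space unit_sphere p" "T v \<bullet> \<xi> p = 0" if "v \<in> tangent_space unit_sphere p" for v
      using that field_norm[OF p] field_orth[OF p]
      by (simp_all add: T_def tangent_iff[OF p] inner_diff_left)
    have h\<xi>: "hess p v (\<xi> p) = - ((v \<bullet> \<xi> p) *\<^sub>R \<xi> p)" if "v \<in> tangent_space unit_sphere p" for v
      using hess_field[OF p that] I[OF p that] by simp
    \<comment> \<open>In the decomposition along \<open>\<xi> p\<close> and its complement the mixed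
      terms vanish by \<open>h\<xi>\<close>; the term with \<open>\<xi> p\<close> in both arguments
      is the subtracted one.\<close>
    have split: "hess p u v = hess p (T u) (T v) - ((u \<bullet> \<xi> p) * (v \<bullet> \<xi> p)) *\<^sub>R \<xi> p"
      if u: "u \<in> tangent_space unit_sphere p" and v: "v \<in> tangent_space unit_sphere p" for u v
    proof -
      have "hess p u v = hess p (T u + (u \<bullet> \<xi> p) *\<^sub>R \<xi> p) v"
        by (simp add: T_def)
      also have "\<dots> = hess p (T u) v + (u \<bullet> \<xi> p) *\<^sub>R hess p (\<xi> p) v"
        by (rule hess_add_left[OF p Tt(1)[OF u] \<xi>t v])
      also have "hess p (\<xi> p) v = - ((v \<bullet> \<xi> p) *\<^sub>R \<xi> p)"
        using hess_commute[OF p \<xi>t v] h\<xi>[OF v] by simp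
      also have "hess p (T u) v = hess p (T v + (v \<bullet> \<xi> p) *\<^sub>R \<xi> p) (T u)"
        using hess_commute[OF p Tt(1)[OF u] v] by (simp add: T_def)
      also have "\<dots> = hess p (T v) (T u) + (v \<bullet> \<xi> p) *\<^sub>R hess p (\<xi> p) (T u)"
        by (rule hess_add_left[OF p Tt(1)[OF v] \<xi>t Tt(1)[OF u]])
      also have "hess p (\<xi> p) (T u) = 0"
        using hess_commute[OF p \<xi>t Tt(1)[OF u]] h\<xi>[OF Tt(1)[OF u]] Tt(2)[OF u] by simp
      finally show ?thesis
        using hess_commute[OF p Tt(1)[OF u] Tt(1)[OF v]] by simp
    qed
    have perp: "hess p x y \<bullet> z = 0" if "z \<bullet> p = 0" "z \<bullet> \<xi> p = 0" for z
    proof -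
      have "hess p (T x) (T y) \<bullet> z = 0"
        using SI[unfolded strongly_normal_iff] Tt[OF x] Tt[OF y] that p by (simp add: tangent_iff)
      then show ?thesis
        unfolding split[OF x y] using that by (simp add: inner_diff_left inner_commute[of "\<xi> p" z])
    qed
    \<comment> \<open>By \<open>hess_inner\<close> this vector is orthogonal to \<open>p\<close> and
      to \<open>\<xi> p\<close>. By \<open>perp\<close> it is then orthogonal to itself.\<close>
    define r where "r = hess p x y + (d p x \<bullet> d p y) *\<^sub>R \<xi> p + (y \<bullet> d p x + x \<bullet> d p y) *\<^sub>R p"
    have r: "r \<bullet> p = 0" "r \<bullet> \<xi> p = 0"
      using p field_norm[OF p] field_orth[OF p] hess_inner[OF p x y]
      by (simp_all add: r_def inner_add_left dot_square_norm inner_commute[of p "\<xi> p"] inner_commute[of "d p y" x])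
    have "r \<bullet> r = hess p x y \<bullet> r"
      using r by (subst (1) r_def) (simp add: inner_add_left inner_commute[of p r] inner_commute[of "\<xi> p" r])
    also have "\<dots> = 0"
      by (rule perp[OF r])
    finally have "r = 0" by simp
    \<comment> \<open>Invariance reduces the last bracket of \<open>tg_cond\<close> to the multiple
      of \<open>\<xi> p\<close> that is subtracted earlier in it.\<close>
    moreover have "(1/2) *\<^sub>R ((x \<bullet> \<xi> p) *\<^sub>R (y + d p (nab p y)) + (y \<bullet> \<xi> p) *\<^sub>R (x + d p (nab p x)))
        = ((x \<bullet> \<xi> p) * (y \<bullet> \<xi> p)) *\<^sub>R \<xi> p"
      unfolding I[OF p x] I[OF p y] by (simp add: mult.commute flip: scaleR_add_left)
    ultimately show "tg_cond p x y"
      unfolding tg_cond_def r_def by (simp add: algebra_simps)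
  qed
qed

end

section \<open>Parity of the dimension\<close>

text \<open>A \<open>J\<close>-invariant subspace of even dimension, chosen with greatest dimension,
  is all of \<open>W\<close>: for \<open>x\<close> outside it, adjoining \<open>x\<close> and
  \<open>J x\<close> would raise the dimension by 2.\<close>

lemma even_dim_complex_structure:
  fixes J :: "'a::euclidean_space \<Rightarrow> 'a"
  assumes J: "linear J" and W: "subspace W" and JW: "\<And>x. x \<in> W \<Longrightarrow> J x \<in> W"
    and JJ: "\<And>x. x \<in> W \<Longrightarrow> J (J x) = - x"
  shows "even (dim W)"
proof -
  define P where "P V \<longleftrightarrow> subspace V \<and> V \<subseteq> W \<and> J ` V \<subseteq> V \<and> even (dim V)" for V
  have "P {0}"
    using W linear_0[OF J] by (auto simp: P_def subspace_0)
  then have "\<exists>V. P V \<and> (\<forall>V'. P V' \<longrightarrow> dim V' \<le> dim V)"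
    by (rule ex_has_greatest_nat[of P "{0}" dim "Suc DIM('a)"]) (auto simp: less_Suc_eq_le dim_subset_UNIV)
  then obtain V where V: "P V" and max: "\<And>V'. P V' \<Longrightarrow> dim V' \<le> dim V"
    by blast
  note V' = V[unfolded P_def]
  have "x \<in> V" if x: "x \<in> W" for x
  proof (rule ccontr)
    assume xV: "x \<notin> V"
    have span: "span V = V"
      using V' by (simp add: span_eq_iff)
    have JxV: "J x \<notin> span V"
    proof
      assume "J x \<in> span V"
      then have "J (J x) \<in> V" using V' span by blast
      then show False
        using xV JJ[OF x] V' subspace_neg[of V "- x"] by simp
    qed
    have "x \<notin> span (insert (J x) V)"
    proof
      assume "x \<in> span (insert (J x) V)"
      then obtain k where k: "x - k *\<^sub>R J x \<in> V"
        unfolding span_breakdown_eq span by blast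
      then have "J (x - k *\<^sub>R J x) \<in> V" using V' by blast
      then have "J x + k *\<^sub>R x \<in> V"
        by (simp add: linear_diff[OF J] linear_cmul[OF J] JJ[OF x])
      \<comment> \<open>This combination eliminates \<open>J x\<close> and leaves
        \<open>1 + k * k\<close> times \<open>x\<close>; the factor is nonzero because
        \<open>k\<close> is real.\<close>
      then have "(x - k *\<^sub>R J x) + k *\<^sub>R (J x + k *\<^sub>R x) \<in> V"
        using k V' by (blast intro: subspace_add subspace_scale)
      then have "(1 + k * k) *\<^sub>R x \<in> V"
        by (simp add: algebra_simps)
      then have "inverse (1 + k * k) *\<^sub>R (1 + k * k) *\<^sub>R x \<in> V"
        using V' subspace_scale by blast
      moreover have "1 + k * k \<noteq> 0"
        using zero_le_square[of k] by linarith
      ultimately show False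
        using xV by simp
    qed
    with JxV have dim: "dim (span (insert x (insert (J x) V))) = dim V + 2"
      by (simp add: dim_insert)
    have "insert x (insert (J x) V) \<subseteq> W"
      using x JW V' by blast
    then have "span (insert x (insert (J x) V)) \<subseteq> W"
      using W span_minimal by blast
    moreover have "J ` insert x (insert (J x) V) \<subseteq> span (insert x (insert (J x) V))"
      using V' JJ[OF x] by (auto intro: span_base span_neg)
    then have "J ` span (insert x (insert (J x) V)) \<subseteq> span (insert x (insert (J x) V))"
      using linear_span_image[OF J, of "insert x (insert (J x) V)"] span_minimal subspace_span by metis
    ultimately have "P (span (insert x (insert (J x) V)))"
      using V' dim by (simp add: P_def)
    from max[OF this] dim show False by simp
  qed
  then have "W = V" using V' by blast
  then show ?thesis using V' by simp
qed

lemma dim_orthogonal_pair: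
  fixes u v :: "'a::euclidean_space"
  assumes "u \<bullet> u = 1" "v \<bullet> v = 1" "u \<bullet> v = 0" "DIM('a) = n + 2"
  shows "dim {x. x \<bullet> u = 0 \<and> x \<bullet> v = 0} = n"
proof -
  have "u \<noteq> v" "u \<noteq> 0" "v \<noteq> 0" using assms by auto
  have "independent {u, v}"
    by (rule pairwise_orthogonal_independent)
      (use assms \<open>u \<noteq> 0\<close> \<open>v \<noteq> 0\<close> in \<open>auto simp: pairwise_def orthogonal_def inner_commute\<close>)
  then have "dim (span {u, v}) = 2"
    using \<open>u \<noteq> v\<close> by (simp add: dim_eq_card_independent)
  moreover have "(\<forall>x\<in>span {u, v}. orthogonal x y) \<longleftrightarrow> y \<bullet> u = 0 \<and> y \<bullet> v = 0" for y
  proof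
    assume "\<forall>x\<in>span {u, v}. orthogonal x y"
    moreover have "u \<in> span {u, v}" "v \<in> span {u, v}"
      by (simp_all add: span_base)
    ultimately show "y \<bullet> u = 0 \<and> y \<bullet> v = 0"
      by (simp add: orthogonal_def inner_commute)
  next
    assume "y \<bullet> u = 0 \<and> y \<bullet> v = 0"
    then show "\<forall>x\<in>span {u, v}. orthogonal x y"
      using orthogonal_to_span[of _ "{u, v}" y] orthogonal_commute by (auto simp: orthogonal_def)
  qed
  then have "{y \<in> UNIV. \<forall>x\<in>span {u, v}. orthogonal x y} = {x. x \<bullet> u = 0 \<and> x \<bullet> v = 0}"
    by simp
  ultimately show ?thesis
    using dim_subspace_orthogonal_to_vectors[of "span {u, v}" UNIV] assms(4) by simp
qed

context unit_geodesic_sphere_field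
begin

lemma invariant_even:
  assumes "invariant_field unit_sphere round_metric \<xi>" "DIM('a) = n + 2"
  shows "even n"
proof -
  \<comment> \<open>One point of the sphere is enough, and a basis vector is at hand.\<close>
  obtain b :: 'a where "b \<in> Basis" using nonempty_Basis by blast
  then have p: "b \<in> unit_sphere" by simp
  let ?W = "{x. x \<bullet> b = 0 \<and> x \<bullet> \<xi> b = 0}"
  have "even (dim ?W)"
  proof (rule even_dim_complex_structure[OF linear_nab[OF p]])
    show "subspace ?W"
      by (simp add: subspace_def inner_add_left)
    fix x assume x: "x \<in> ?W"
    then have xt: "x \<in> tangent_space unit_sphere b"
      by (simp add: tangent_iff[OF p])
    show "nab b x \<in> ?W"
      using nab_tangent[OF p xt] nab_inner_field[OF p xt] by (simp add: tangent_iff[OF p])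
    have "d b (nab b x) = - x"
      using assms(1) p xt x unfolding invariant_iff by simp
    then show "nab b (nab b x) = - x"
      using nab_inner_field[OF p xt] by (simp add: nab_def[of b "nab b x"])
  qed
  moreover have "dim ?W = n"
    using p field_norm[OF p] field_orth[OF p] assms(2)
    by (intro dim_orthogonal_pair) (auto simp: dot_square_norm inner_commute)
  ultimately show ?thesis by simp
qed

end

theorem theorem3p2:
  fixes n :: nat and \<xi> :: "'a::euclidean_space \<Rightarrow> 'a"
  assumes "DIM('a) = n + 2"
    and "unit_vector_field unit_sphere round_metric \<xi>"
    and "geodesic_field unit_sphere round_metric \<xi>"
  shows "totally_geodesic_field unit_sphere round_metric \<xi> \<longleftrightarrow>
    (\<exists>m::int. int n = 2 * m) \<and>
    strongly_normal unit_sphere round_metric \<xi> \<and>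
    invariant_field unit_sphere round_metric \<xi>"
proof -
  interpret unit_geodesic_sphere_field \<xi>
    using assms(2,3) by unfold_locales
  \<comment> \<open>Parity follows from invariance, so it can be adjoined to the equivalence already
    proved.\<close>
  have "\<exists>m::int. int n = 2 * m" if "invariant_field unit_sphere round_metric \<xi>"
    using invariant_even[OF that assms(1)] by (metis dvdE even_of_nat)
  then show ?thesis
    using totally_geodesic_iff_strongly_normal_invariant by blast
qed

end
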